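(* Let $$f(\zeta,u)=F(e^{iu}\zeta)+g\,e^{iu}\zeta,$$ where $F$ is an analytic function of one variable and $g=g(u)$ is a complex-valued function, and suppose that the corresponding vacuum pp-wave satisfies $\alpha\ne0$, $\mu\neq0$ and $AA^*\neq1$ (so that it belongs to the $\mathrm C_{23}$ class). Then the following are equivalent: (i) $d\alpha\wedge d\alpha^*\wedge d\nu=0$; (ii) $\hat\Upsilon=0$; (iii) $g'(u)=0$.
   Context: Setting. Everything is local, on a small connected coordinate domain with coordinates $(\zeta,\zeta^*,u,v)$, $\zeta$ complex, $u,v$ real; $^*$ (or a bar) is complex conjugation. A (non-flat) vacuum pp-wave is a metric $ds^2=2\,d\zeta\,d\bar\zeta-2\,du\,dv-2(f+\bar f)\,du^2$ with $f=f(\zeta,u)$ complex analytic in $\zeta$, smooth in $u$, $f_{\zeta\zeta}\neq0$ everywhere. Inequalities "$\ne$" are meant at every point, equalities identically. Normalized tetrad and scalars. Let $a=\tfrac14\log f_{\zeta\zeta}$ and $\alpha=e^{a-a^*}(a_\zeta)^*$. If $\alpha\neq0$, write $\zeta=Z(a,u)$, $L=\log Z_a$ (functions of $(a,u)$), and let $\omega^1=(\alpha^* )^{-1}da=e^{a-a^*}(d\zeta-Z_u\,du)$, $\omega^2=(\omega^1)^*$, $\omega^3=e^{a+a^*}du$, $\omega^4=e^{-a-a^*}\big((f+f^*+Z_uZ_u^* )du+dv-Z_u\,d\zeta^*-Z_u^*\,d\zeta\big)$, so the metric is $2\omega^1\omega^2-2\omega^3\omega^4$. Its dual frame $(\delta,\delta^*,\Delta,D)$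 is the null tetrad normalized by $\Psi_4=1$, $\gamma=0$ (Newman–Penrose notation). On functions of $(a,a^*,u)$: $\delta Q=\alpha^*Q_a$, $\delta^*Q=\alpha Q_{a^*}$, $\Delta Q=e^{-a-a^*}Q_u$ ($a,a^*$ fixed), $DQ=0$. The remaining spin coefficients are $\mu=e^{-a-a^*}L_u$ and $\nu=e^{-a-3a^*}(Z_{uu}+(f_\zeta)^* )$. Invariants: $A=\delta^*\alpha/\alpha^2$; $B=\mu A-\mu^*$; and, where $AA^*\neq1$, $X=B/(AA^*-1)$, $X_2=\operatorname{Im}X$, $\hat\nu=\nu+X(\mu+2X^* )/\alpha^*$, $\hat\Upsilon=\Delta(\hat\nu/X^* )-2\hat\nu+1/\alpha-4iXX_2/\alpha^*$. *)

theory Defs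
  imports "HOL-Complex_Analysis.Complex_Analysis"
begin

text \<open>
  A point of the coordinate domain is a triple \<open>(\<zeta>, u, v)\<close>; a real tangent vector at it is again
  such a triple, written \<open>(d\<zeta>, du, dv)\<close>. Functions of \<open>(\<zeta>, u)\<close> or of \<open>(a, u)\<close> that are
  holomorphic in the complex argument are curried functions of type \<open>zufun\<close>.
\<close>

type_synonym point = "complex \<times> real \<times> real"
type_synonym zufun = "complex \<Rightarrow> real \<Rightarrow> complex"

definition pd_hol :: "zufun \<Rightarrow> complex \<Rightarrow> real \<Rightarrow> complex" where
  "pd_hol h z u = deriv (\<lambda>w. h w u) z"

definition pd_u :: "zufun \<Rightarrow> complex \<Rightarrow> real \<Rightarrow> complex" where
  "pd_u h z u = vector_derivative (h z) (at u)"

definition zu_dom :: "point set \<Rightarrow> (complex \<times> real) set" where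
  "zu_dom D = (\<lambda>(z, u, v). (z, u)) ` D"

text \<open>
  For a function holomorphic in its complex argument, joint continuity of all the iterated
  \<open>u\<close>-derivatives is the same as joint smoothness (Cauchy's formula).
\<close>

definition smooth_in_u :: "(complex \<times> real) set \<Rightarrow> zufun \<Rightarrow> bool" where
  "smooth_in_u E h \<longleftrightarrow>
     (\<forall>k. continuous_on E (\<lambda>(z, u). (pd_u ^^ k) h z u) \<and>
          (\<forall>(z, u) \<in> E. (pd_u ^^ k) h z differentiable (at u)))"

definition vacuum_pp_wave :: "point set \<Rightarrow> zufun \<Rightarrow> bool" where
  "vacuum_pp_wave D f \<longleftrightarrow>
     open D \<and> connected D \<and>
     (\<forall>u. (\<lambda>z. f z u) holomorphic_on {z. (z, u) \<in> zu_dom D}) \<and>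
     smooth_in_u (zu_dom D) f \<and>
     (\<forall>(z, u) \<in> zu_dom D. pd_hol (pd_hol f) z u \<noteq> 0)"

text \<open>
  The domain is small enough for the choices made in the construction of the tetrad: \<open>a\<close> is a
  continuous branch of \<open>1/4 log f\<^sub>\<zeta>\<^sub>\<zeta>\<close>, the map \<open>Z\<close> inverts \<open>\<zeta> \<mapsto> a(\<zeta>, u)\<close> at fixed \<open>u\<close>, and \<open>L\<close> is
  a continuous branch of \<open>log Z\<^sub>a\<close>. The values of \<open>Z\<close> and \<open>L\<close> outside the (open) set of all
  \<open>(a(\<zeta>, u), u)\<close> are irrelevant.
\<close>

definition adapted_functions ::
  "point set \<Rightarrow> zufun \<Rightarrow> zufun \<Rightarrow>
   zufun \<Rightarrow> zufun \<Rightarrow> bool" where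
  "adapted_functions D f a Z L \<longleftrightarrow>
     continuous_on (zu_dom D) (\<lambda>(z, u). a z u) \<and>
     (\<forall>(z, u) \<in> zu_dom D. exp (4 * a z u) = pd_hol (pd_hol f) z u) \<and>
     (\<forall>(z, u) \<in> zu_dom D. Z (a z u) u = z) \<and>
     continuous_on ((\<lambda>(z, u). (a z u, u)) ` zu_dom D) (\<lambda>(b, u). L b u) \<and>
     (\<forall>(z, u) \<in> zu_dom D. exp (L (a z u) u) = pd_hol Z (a z u) u)"

text \<open>The metric \<open>2 d\<zeta> d\<zeta>\<^sup>* - 2 du dv - 2 (f + f\<^sup>*) du\<^sup>2\<close> as a quadratic form on tangent vectors.\<close>

definition pp_metric :: "zufun \<Rightarrow> point \<Rightarrow> point \<Rightarrow> complex" where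
  "pp_metric f = (\<lambda>(z, u, v) (dz, du, dv).
     2 * dz * cnj dz - 2 * of_real du * of_real dv - 2 * (f z u + cnj (f z u)) * (of_real du)\<^sup>2)"

text \<open>
  Differentiating \<open>Z(a(\<zeta>, u), u) = \<zeta>\<close> gives \<open>da = a\<^sub>\<zeta> (d\<zeta> - Z\<^sub>u du)\<close>, so that \<open>omega1\<close> is also
  \<open>(\<alpha>\<^sup>*)\<^sup>-\<^sup>1 da\<close>.
\<close>

definition omega1 ::
  "zufun \<Rightarrow> zufun \<Rightarrow> point \<Rightarrow> point \<Rightarrow> complex" where
  "omega1 a Z = (\<lambda>(z, u, v) (dz, du, dv).
     exp (a z u - cnj (a z u)) * (dz - pd_u Z (a z u) u * of_real du))"

definition omega2 ::
  "zufun \<Rightarrow> zufun \<Rightarrow> point \<Rightarrow> point \<Rightarrow> complex" where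
  "omega2 a Z p x = cnj (omega1 a Z p x)"

definition omega3 :: "zufun \<Rightarrow> point \<Rightarrow> point \<Rightarrow> complex" where
  "omega3 a = (\<lambda>(z, u, v) (dz, du, dv). exp (a z u + cnj (a z u)) * of_real du)"

definition omega4 ::
  "zufun \<Rightarrow> zufun \<Rightarrow> zufun \<Rightarrow>
   point \<Rightarrow> point \<Rightarrow> complex" where
  "omega4 f a Z = (\<lambda>(z, u, v) (dz, du, dv).
     exp (- a z u - cnj (a z u)) *
       ((f z u + cnj (f z u) + pd_u Z (a z u) u * cnj (pd_u Z (a z u) u)) * of_real du
        + of_real dv - pd_u Z (a z u) u * cnj dz - cnj (pd_u Z (a z u) u) * dz))"

lemma pp_metric_coframe:
  "pp_metric f p x = 2 * omega1 a Z p x * omega2 a Z p x - 2 * omega3 a p x * omega4 f a Z p x"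
proof -
  obtain z u v dz du dv where p: "p = (z, u, v)" "x = (dz, du, dv)"
    by (metis prod_cases3)
  define s t where "s = a z u" and "t = cnj (a z u)"
  have e: "exp (s - t) * exp (t - s) = 1" "exp (s + t) * exp (- s - t) = 1"
    by (simp_all flip: exp_add)
  define Y where "Y = pd_u Z (a z u) u"
  have "2 * omega1 a Z p x * omega2 a Z p x =
      2 * (exp (s - t) * exp (t - s)) * ((dz - Y * of_real du) * (cnj dz - cnj Y * of_real du))"
    by (simp add: p omega1_def omega2_def s_def t_def Y_def exp_cnj)
  moreover have "2 * omega3 a p x * omega4 f a Z p x = 2 * (exp (s + t) * exp (- s - t)) *
      (of_real du * ((f z u + cnj (f z u) + Y * cnj Y) * of_real du
        + of_real dv - Y * cnj dz - cnj Y * dz))"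
    by (simp add: p omega3_def omega4_def s_def t_def Y_def)
  ultimately have "2 * omega1 a Z p x * omega2 a Z p x - 2 * omega3 a p x * omega4 f a Z p x =
      2 * ((dz - Y * of_real du) * (cnj dz - cnj Y * of_real du))
      - 2 * (of_real du * ((f z u + cnj (f z u) + Y * cnj Y) * of_real du
        + of_real dv - Y * cnj dz - cnj Y * dz))"
    by (simp only: e mult_1_right)
  then show ?thesis by (simp add: p pp_metric_def algebra_simps power2_eq_square)
qed

text \<open>
  The (complex-valued, real-linear) differential of a scalar, and the derivatives
  \<open>(\<delta>Q, \<delta>\<^sup>*Q, \<Delta>Q, DQ)\<close> along the frame dual to \<open>(\<omega>\<^sup>1, \<omega>\<^sup>2, \<omega>\<^sup>3, \<omega>\<^sup>4)\<close>, which are the coefficients in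
  \<open>dQ = \<delta>Q \<omega>\<^sup>1 + \<delta>\<^sup>*Q \<omega>\<^sup>2 + \<Delta>Q \<omega>\<^sup>3 + DQ \<omega>\<^sup>4\<close>.
\<close>

definition differential :: "(point \<Rightarrow> complex) \<Rightarrow> point \<Rightarrow> point \<Rightarrow> complex" where
  "differential Q p = frechet_derivative Q (at p)"

definition frame_derivs ::
  "zufun \<Rightarrow> zufun \<Rightarrow> zufun \<Rightarrow>
   (point \<Rightarrow> complex) \<Rightarrow> point \<Rightarrow> complex \<times> complex \<times> complex \<times> complex" where
  "frame_derivs f a Z Q p = (THE (c1, c2, c3, c4). \<forall>x. differential Q p x =
     c1 * omega1 a Z p x + c2 * omega2 a Z p x + c3 * omega3 a p x + c4 * omega4 f a Z p x)"

definition delta_star ::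
  "zufun \<Rightarrow> zufun \<Rightarrow> zufun \<Rightarrow>
   (point \<Rightarrow> complex) \<Rightarrow> point \<Rightarrow> complex" where
  "delta_star f a Z Q p = (case frame_derivs f a Z Q p of (c1, c2, c3, c4) \<Rightarrow> c2)"

definition Delta ::
  "zufun \<Rightarrow> zufun \<Rightarrow> zufun \<Rightarrow>
   (point \<Rightarrow> complex) \<Rightarrow> point \<Rightarrow> complex" where
  "Delta f a Z Q p = (case frame_derivs f a Z Q p of (c1, c2, c3, c4) \<Rightarrow> c3)"

lemma coframe_basis:
  assumes "linear T"
  shows "\<exists>!(c1, c2, c3, c4). \<forall>x. T x =
    c1 * omega1 a Z p x + c2 * omega2 a Z p x + c3 * omega3 a p x + c4 * omega4 f a Z p x"
proof -
  obtain z u v where p: "p = (z, u, v)" by (metis prod_cases3)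
  define m1 m2 m3 m4 where m: "m1 = exp (a z u - cnj (a z u))" "m2 = exp (cnj (a z u) - a z u)"
    "m3 = exp (a z u + cnj (a z u))" "m4 = exp (- a z u - cnj (a z u))"
  have nz: "m1 \<noteq> 0" "m2 \<noteq> 0" "m3 \<noteq> 0" "m4 \<noteq> 0" by (simp_all add: m)
  define Y where "Y = pd_u Z (a z u) u"
  define H where "H = f z u + cnj (f z u) + Y * cnj Y"
  define t r s0 s1 where trs: "t = T (0, 1, 0)" "r = T (0, 0, 1)"
    "s0 = (T (1, 0, 0) - \<i> * T (\<i>, 0, 0)) / 2" "s1 = (T (1, 0, 0) + \<i> * T (\<i>, 0, 0)) / 2"
  have w1: "omega1 a Z p (dz, du, dv) = m1 * (dz - Y * of_real du)" for dz du dv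
    by (simp add: omega1_def p m Y_def)
  have w2: "omega2 a Z p (dz, du, dv) = m2 * (cnj dz - cnj Y * of_real du)" for dz du dv
    by (simp add: omega2_def omega1_def p m Y_def exp_cnj)
  have w3: "omega3 a p (dz, du, dv) = m3 * of_real du" for dz du dv
    by (simp add: omega3_def p m)
  have w4: "omega4 f a Z p (dz, du, dv) =
      m4 * (H * of_real du + of_real dv - Y * cnj dz - cnj Y * dz)" for dz du dv
    by (simp add: omega4_def p m Y_def H_def)
  have T: "T (dz, du, dv) = s0 * dz + s1 * cnj dz + t * of_real du + r * of_real dv" for dz du dv
  proof -
    have "(dz, du, dv) = Re dz *\<^sub>R (1, 0, 0) + Im dz *\<^sub>R (\<i>, 0, 0)
        + du *\<^sub>R (0, 1, 0) + dv *\<^sub>R (0, 0, 1)"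
      by (simp add: complex_eq_iff)
    then have "T (dz, du, dv) = T (Re dz *\<^sub>R (1, 0, 0) + Im dz *\<^sub>R (\<i>, 0, 0)
        + du *\<^sub>R (0, 1, 0) + dv *\<^sub>R (0, 0, 1))" by (rule arg_cong)
    also have "\<dots> = of_real (Re dz) * T (1, 0, 0) + of_real (Im dz) * T (\<i>, 0, 0) + t * of_real du
        + r * of_real dv"
      by (simp only: linear_add[OF assms] linear_scale[OF assms] trs scaleR_conv_of_real
          mult.commute)
    also have "of_real (Re dz) * T (1, 0, 0) + of_real (Im dz) * T (\<i>, 0, 0) = s0 * dz + s1 * cnj dz"
      unfolding trs by (simp add: complex_eq_iff field_simps)
    finally show ?thesis .
  qed
  have "(\<forall>x. T x = c1 * omega1 a Z p x + c2 * omega2 a Z p x + c3 * omega3 a p x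
      + c4 * omega4 f a Z p x) \<longleftrightarrow>
      c1 = (s0 + r * cnj Y) / m1 \<and> c2 = (s1 + r * Y) / m2 \<and>
      c3 = (t + (s0 + r * cnj Y) * Y + (s1 + r * Y) * cnj Y - r * H) / m3 \<and> c4 = r / m4"
    (is "?l \<longleftrightarrow> ?r") for c1 c2 c3 c4
  proof
    assume l: ?l
    have eq: "s0 * dz + s1 * cnj dz + t * of_real du + r * of_real dv =
        (c1 * m1) * (dz - Y * of_real du) + (c2 * m2) * (cnj dz - cnj Y * of_real du)
        + (c3 * m3) * of_real du
        + (c4 * m4) * (H * of_real du + of_real dv - Y * cnj dz - cnj Y * dz)" for dz du dv
      using l[rule_format, of "(dz, du, dv)"] by (simp add: T w1 w2 w3 w4 mult.assoc)
    have 4: "c4 * m4 = r" using eq[of 0 0 1] by simp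
    have "s0 + s1 = c1 * m1 + c2 * m2 - r * Y - r * cnj Y"
      using eq[of 1 0 0] by (simp add: 4 algebra_simps)
    moreover have "\<i> * (s0 - s1) = \<i> * (c1 * m1 - c2 * m2 + r * Y - r * cnj Y)"
      using eq[of \<i> 0 0] by (simp add: 4 algebra_simps)
    then have "s0 - s1 = c1 * m1 - c2 * m2 + r * Y - r * cnj Y" by simp
    ultimately have "2 * (c1 * m1) = 2 * (s0 + r * cnj Y)" "2 * (c2 * m2) = 2 * (s1 + r * Y)"
      by algebra+
    then have 12: "c1 * m1 = s0 + r * cnj Y" "c2 * m2 = s1 + r * Y"
      using mult_left_cancel[of "2::complex"] zero_neq_numeral by metis+
    have "c3 * m3 = t + (s0 + r * cnj Y) * Y + (s1 + r * Y) * cnj Y - r * H"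
      using eq[of 0 1 0] by (simp add: 4 12)
    with 4 12 nz show ?r by (simp add: eq_divide_eq)
  next
    assume r: ?r
    then have "c1 * m1 = s0 + r * cnj Y" "c2 * m2 = s1 + r * Y" "c4 * m4 = r"
      "c3 * m3 = t + (s0 + r * cnj Y) * Y + (s1 + r * Y) * cnj Y - r * H"
      using nz by simp_all
    then show ?l
      by (auto simp: T w1 w2 w3 w4 simp flip: mult.assoc) (simp add: algebra_simps)
  qed
  then show ?thesis by auto
qed

definition alpha :: "zufun \<Rightarrow> point \<Rightarrow> complex" where
  "alpha a = (\<lambda>(z, u, v). exp (a z u - cnj (a z u)) * cnj (pd_hol a z u))"

definition mu :: "zufun \<Rightarrow> zufun \<Rightarrow> point \<Rightarrow> complex" where
  "mu a L = (\<lambda>(z, u, v). exp (- a z u - cnj (a z u)) * pd_u L (a z u) u)"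

definition nu ::
  "zufun \<Rightarrow> zufun \<Rightarrow> zufun \<Rightarrow>
   point \<Rightarrow> complex" where
  "nu f a Z = (\<lambda>(z, u, v).
     exp (- a z u - 3 * cnj (a z u)) * (pd_u (pd_u Z) (a z u) u + cnj (pd_hol f z u)))"

definition inv_A ::
  "zufun \<Rightarrow> zufun \<Rightarrow> zufun \<Rightarrow>
   point \<Rightarrow> complex" where
  "inv_A f a Z p = delta_star f a Z (alpha a) p / (alpha a p)\<^sup>2"

definition inv_B ::
  "zufun \<Rightarrow> zufun \<Rightarrow> zufun \<Rightarrow>
   zufun \<Rightarrow> point \<Rightarrow> complex" where
  "inv_B f a Z L p = mu a L p * inv_A f a Z p - cnj (mu a L p)"

definition inv_X ::
  "zufun \<Rightarrow> zufun \<Rightarrow> zufun \<Rightarrow>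
   zufun \<Rightarrow> point \<Rightarrow> complex" where
  "inv_X f a Z L p = inv_B f a Z L p / (inv_A f a Z p * cnj (inv_A f a Z p) - 1)"

definition nu_hat ::
  "zufun \<Rightarrow> zufun \<Rightarrow> zufun \<Rightarrow>
   zufun \<Rightarrow> point \<Rightarrow> complex" where
  "nu_hat f a Z L p = nu f a Z p +
     inv_X f a Z L p * (mu a L p + 2 * cnj (inv_X f a Z L p)) / cnj (alpha a p)"

text \<open>
  The quotient by \<open>X\<^sup>*\<close> is genuine whenever \<open>\<mu> \<noteq> 0\<close> and \<open>A A\<^sup>* \<noteq> 1\<close>: if \<open>X\<close> vanished then
  \<open>\<mu> A = \<mu>\<^sup>*\<close>, whence \<open>A A\<^sup>* = 1\<close>.
\<close>

definition Upsilon_hat ::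
  "zufun \<Rightarrow> zufun \<Rightarrow> zufun \<Rightarrow>
   zufun \<Rightarrow> point \<Rightarrow> complex" where
  "Upsilon_hat f a Z L p =
     Delta f a Z (\<lambda>q. nu_hat f a Z L q / cnj (inv_X f a Z L q)) p
     - 2 * nu_hat f a Z L p + 1 / alpha a p
     - 4 * \<i> * inv_X f a Z L p * of_real (Im (inv_X f a Z L p)) / cnj (alpha a p)"

text \<open>Wedge product in the determinant normalization, evaluated on three tangent vectors.\<close>

definition wedge3 ::
  "(point \<Rightarrow> complex) \<Rightarrow> (point \<Rightarrow> complex) \<Rightarrow> (point \<Rightarrow> complex) \<Rightarrow>
   point \<Rightarrow> point \<Rightarrow> point \<Rightarrow> complex" where
  "wedge3 \<phi> \<psi> \<theta> x y w =
     \<phi> x * \<psi> y * \<theta> w + \<phi> y * \<psi> w * \<theta> x + \<phi> w * \<psi> x * \<theta> y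
     - \<phi> x * \<psi> w * \<theta> y - \<phi> y * \<psi> x * \<theta> w - \<phi> w * \<psi> y * \<theta> x"

end

theory Submission imports Defs begin

text \<open>
  In the rotating coordinate \<open>s = exp(iu) \<zeta>\<close> one has \<open>f\<^sub>\<zeta>\<^sub>\<zeta> = exp(2iu) F''(s)\<close>, so locally
  \<open>a = iu/2 + b\<close> with \<open>b = h(s)\<close>, \<open>h = 1/4 log F''\<close>, and \<open>Z(a, u) = exp(-iu) H(a - iu/2)\<close> with \<open>H\<close>
  the local inverse of \<open>h\<close>. Then \<open>\<alpha>\<close> and \<open>A\<close> depend on \<open>(b, b\<^sup>*)\<close> only, \<open>X = (i/2) exp(-b-b\<^sup>*)\<close>, and
  \<open>\<nu>\<close> is a function of \<open>(b, b\<^sup>*)\<close> plus \<open>exp(-b-3b\<^sup>*) g\<^sup>*\<close>. Since \<open>A A\<^sup>* \<noteq> 1\<close> makes \<open>d\<alpha>\<close> and \<open>d\<alpha>\<^sup>*\<close>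
  independent, the wedge product is a nonvanishing function times \<open>(g')\<^sup>* db \<and> db\<^sup>* \<and> du\<close>, while
  the last invariant comes out as \<open>2i exp(-b-3b\<^sup>*) (g')\<^sup>*\<close>. Thus the equivalences even hold pointwise.
\<close>

section \<open>Derivative rules and the algebra of the wedge product\<close>

lemma has_derivative_field_compose:
  assumes "(k has_derivative k') (at x)" "(\<phi> has_field_derivative d) (at (k x))"
  shows "((\<lambda>y. \<phi> (k y)) has_derivative (\<lambda>y. d * k' y)) (at x)"
  using has_derivative_compose[OF assms(1), of \<phi> "(*) d"] assms(2)
  by (simp add: has_field_derivative_def)

lemmas has_derivative_exp_compose = has_derivative_field_compose[OF _ DERIV_exp]

text \<open>Near \<open>u\<close> the value \<open>l t\<close> stays within distance
  \<open>pi\<close> of \<open>l u\<close>, so the principal \<open>Ln\<close> of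
  \<open>G t / G u\<close> recovers \<open>l t - l u\<close> and can be differentiated in its place.
  This is what makes \<open>L\<close> differentiable in \<open>u\<close>, as it is given only as a
  continuous branch of a logarithm.\<close>

lemma has_vector_derivative_continuous_log:
  fixes G l :: "real \<Rightarrow> complex"
  assumes "isCont l u" and ev: "\<forall>\<^sub>F t in nhds u. exp (l t) = G t"
    and G: "(G has_vector_derivative G') (at u)"
  shows "(l has_vector_derivative G' / G u) (at u)"
proof -
  have Gu: "exp (l u) = G u" using ev by (rule eventually_nhds_x_imp_x)
  then have nz: "G u \<noteq> 0" by (metis exp_not_eq_zero)
  have "(l \<longlongrightarrow> l u) (nhds u)"
    using assms(1) by (simp add: isCont_def tendsto_at_iff_tendsto_nhds)
  then have "\<forall>\<^sub>F t in nhds u. dist (l t) (l u) < pi"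
    by (rule tendstoD) simp
  with ev have "\<forall>\<^sub>F t in nhds u. l u + Ln (G t / G u) = l t"
  proof eventually_elim
    case (elim t)
    have "\<bar>Im (l t - l u)\<bar> < pi"
      using abs_Im_le_cmod[of "l t - l u"] elim(2) by (simp add: dist_norm)
    then have "Ln (exp (l t - l u)) = l t - l u" by (intro Ln_exp) auto
    with elim(1) Gu show ?case by (simp add: exp_diff)
  qed
  moreover have "((\<lambda>t. l u + Ln (G t / G u)) has_vector_derivative G' / G u) (at u)"
  proof -
    have "((Ln \<circ> (\<lambda>t. G t / G u)) has_vector_derivative G' / G u * inverse (G u / G u)) (at u)"
      by (intro field_vector_diff_chain_at has_vector_derivative_divide G has_field_derivative_Ln)
        (simp add: nz)
    then show ?thesis using nz has_vector_derivative_add[OF has_vector_derivative_const[of "l u"]]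
      by (fastforce simp: o_def)
  qed
  ultimately show ?thesis
    using Gu nz by (subst (asm) has_vector_derivative_cong_ev[where g = l]) auto
qed

text \<open>The derivative keeps the shape of the function, with \<open>G\<close> replaced by
  \<open>- \<i> * (G + G' / 2)\<close>, so the rule can be iterated. It serves for \<open>Z\<close>,
  for its \<open>u\<close>-derivative and for \<open>exp L\<close>.\<close>

lemma has_vector_derivative_cis_mult_holomorphic:
  assumes "G holomorphic_on T" "open T" "c - \<i> * of_real u / 2 \<in> T"
  shows "((\<lambda>t. cis (- t) * G (c - \<i> * of_real t / 2)) has_vector_derivative
    - \<i> * cis (- u) * (G (c - \<i> * of_real u / 2) + deriv G (c - \<i> * of_real u / 2) / 2)) (at u)"
proof -
  have "((\<lambda>t. c - \<i> * of_real t / 2) has_vector_derivative - \<i> / 2) (at u)"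
    by (auto intro!: derivative_eq_intros has_vector_derivative_diff simp: has_vector_derivative_def
      scaleR_conv_of_real)
  from field_vector_diff_chain_at[OF this holomorphic_derivI[OF assms]]
  have 1: "((\<lambda>t. G (c - \<i> * of_real t / 2)) has_vector_derivative
    - \<i> / 2 * deriv G (c - \<i> * of_real u / 2)) (at u)" by (simp add: o_def)
  have "((\<lambda>t. - \<i> * of_real t) has_vector_derivative - \<i>) (at u)"
    by (auto intro!: derivative_eq_intros simp: has_vector_derivative_def scaleR_conv_of_real)
  from field_vector_diff_chain_at[OF this DERIV_exp]
  have 2: "((\<lambda>t. cis (- t)) has_vector_derivative - \<i> * cis (- u)) (at u)"
    by (simp add: o_def cis_conv_exp)
  show ?thesis
    using has_vector_derivative_mult[OF 2 1] by (simp add: algebra_simps)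
qed

lemma cnj_exp_real: "cnj (exp (- w - cnj w)) = exp (- w - cnj w)"
  by (simp add: exp_cnj minus_diff_commute)

text \<open>A threefold wedge in \<open>d\<close>, \<open>e\<close>, \<open>t\<close> sees only the
  determinant of the coefficients. With no \<open>t\<close> in the first two forms this is
  \<open>n3\<close> times a 2 by 2 minor, and \<open>n1\<close>, \<open>n2\<close> drop out.\<close>

lemma wedge3_combination:
  "wedge3 (\<lambda>x. c1 * d x + c2 * e x) (\<lambda>x. c3 * d x + c4 * e x) (\<lambda>x. n1 * d x + n2 * e x + n3 * t x) x y w
    = n3 * (c1 * c4 - c2 * c3) * wedge3 d e t x y w"
  unfolding wedge3_def by algebra

section \<open>The local model in the rotating coordinate\<close>

text \<open>
  The equations for \<open>Z\<close> and \<open>L\<close> are required at fixed \<open>a\<close>, for \<open>u\<close> in a neighbourhood, because the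
  \<open>u\<close>-derivatives of these functions are taken in the coordinates \<open>(a, u)\<close>.
\<close>

locale rotating_chart =
  fixes f a Z L :: zufun and F :: "complex \<Rightarrow> complex" and g :: "real \<Rightarrow> complex"
    and h H :: "complex \<Rightarrow> complex" and S T :: "complex set" and M :: "point set"
  assumes open_S: "open S" and open_T: "open T" and open_M: "open M"
    and h_hol: "h holomorphic_on S" and H_hol: "H holomorphic_on T" and F_hol: "F holomorphic_on S"
    and h_in: "s \<in> S \<Longrightarrow> h s \<in> T" and H_h: "s \<in> S \<Longrightarrow> H (h s) = s"
    and H_in: "t \<in> T \<Longrightarrow> H t \<in> S"
    and exp_h: "s \<in> S \<Longrightarrow> exp (4 * h s) = deriv (deriv F) s"
    and M_S: "(z, u, v) \<in> M \<Longrightarrow> cis u * z \<in> S"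
    and a_eq: "(z, u, v) \<in> M \<Longrightarrow> a z u = \<i> * of_real u / 2 + h (cis u * z)"
    and Z_eq: "(z, u, v) \<in> M \<Longrightarrow>
      \<forall>\<^sub>F t in nhds u. Z (a z u) t = cis (- t) * H (a z u - \<i> * of_real t / 2)"
    and L_eq: "(z, u, v) \<in> M \<Longrightarrow>
      \<forall>\<^sub>F t in nhds u. exp (L (a z u) t) = cis (- t) * deriv H (a z u - \<i> * of_real t / 2)"
    and L_cont: "(z, u, v) \<in> M \<Longrightarrow> isCont (L (a z u)) u"
    and f_deriv: "(z, u, v) \<in> M \<Longrightarrow> pd_hol f z u = cis u * (deriv F (cis u * z) + g u)"
    and g_diff: "(z, u, v) \<in> M \<Longrightarrow> g differentiable (at u)"
begin

definition b :: "point \<Rightarrow> complex" where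
  "b = (\<lambda>(z, u, v). h (cis u * z))"

text \<open>The differential of \<open>b\<close>, as \<open>b_has_derivative\<close> confirms. The
  derivative of \<open>h\<close> is written as the reciprocal of that of \<open>H\<close>, so that
  later formulas involve derivatives of \<open>H\<close> only.\<close>

definition db :: "point \<Rightarrow> point \<Rightarrow> complex" where
  "db = (\<lambda>(z, u, v) (dz, du, dv).
    cis u * (dz + \<i> * z * of_real du) / deriv H (h (cis u * z)))"

abbreviation "H1 \<equiv> deriv H"
abbreviation "H2 \<equiv> deriv (deriv H)"

section \<open>Spin coefficients as functions of \<open>b\<close>\<close>

lemma H1_hol: "H1 holomorphic_on T" and H2_hol: "H2 holomorphic_on T"
  by (intro holomorphic_deriv H_hol open_T)+

lemma b_in: "q \<in> M \<Longrightarrow> b q \<in> T"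
  by (auto simp: b_def split: prod.splits intro: h_in M_S)

lemma a_u: "(z, u, v) \<in> M \<Longrightarrow> a z u - \<i> * of_real u / 2 = b (z, u, v)"
  by (simp add: a_eq b_def)

text \<open>Chain rule for \<open>H (h s) = s\<close>. The identity turns \<open>h'\<close> into
  \<open>1 / H1\<close> and shows that \<open>H1\<close> has no zero among the values of
  \<open>b\<close> on \<open>M\<close>.\<close>

lemma H1_h: "s \<in> S \<Longrightarrow> H1 (h s) * deriv h s = 1"
proof -
  assume s: "s \<in> S"
  have "((\<lambda>w. H (h w)) has_field_derivative H1 (h s) * deriv h s) (at s)"
    by (rule DERIV_chain2[OF holomorphic_derivI[OF H_hol open_T h_in[OF s]]
        holomorphic_derivI[OF h_hol open_S s]])
  then have "((\<lambda>w. w) has_field_derivative H1 (h s) * deriv h s) (at s)"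
    by (rule has_field_derivative_transform_within_open[OF _ open_S s]) (simp add: H_h)
  then show ?thesis using DERIV_unique DERIV_ident by blast
qed

lemma H1_nz: "q \<in> M \<Longrightarrow> H1 (b q) \<noteq> 0"
  using H1_h M_S by (fastforce simp: b_def split: prod.splits)

lemma eventually_slice:
  assumes "(z, u, v) \<in> M"
  shows "\<forall>\<^sub>F w in nhds z. (w, u, v) \<in> M"
proof -
  have "open ((\<lambda>w. (w, u, v)) -` M)"
    by (intro open_vimage open_M continuous_intros)
  then show ?thesis using assms eventually_nhds_in_open by fastforce
qed

lemma pd_hol_a:
  assumes "(z, u, v) \<in> M"
  shows "pd_hol a z u = cis u / H1 (b (z, u, v))"
proof -
  have s: "cis u * z \<in> S" using assms by (rule M_S)
  have "((\<lambda>w. \<i> * of_real u / 2 + h (cis u * w)) has_field_derivative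
      deriv h (cis u * z) * cis u) (at z)"
    by (auto intro!: derivative_eq_intros DERIV_chain2[where f = h]
        holomorphic_derivI[OF h_hol open_S s])
  then have "deriv (\<lambda>w. \<i> * of_real u / 2 + h (cis u * w)) z = deriv h (cis u * z) * cis u"
    by (rule DERIV_imp_deriv)
  moreover have "pd_hol a z u = deriv (\<lambda>w. \<i> * of_real u / 2 + h (cis u * w)) z"
    unfolding pd_hol_def
    by (rule deriv_cong_ev) (auto intro: eventually_mono[OF eventually_slice[OF assms]] simp: a_eq)
  ultimately show ?thesis
    using H1_h[OF s] H1_nz[OF assms] by (simp add: b_def field_simps)
qed

text \<open>The summand \<open>\<i> * u / 2\<close> of \<open>a\<close> cancels against its
  conjugate in \<open>a + cnj a\<close>, and amounts to \<open>\<i> * u\<close> both in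
  \<open>a - cnj a\<close> and in \<open>- a - 3 * cnj a\<close>.\<close>

lemma exp_a:
  assumes "(z, u, v) \<in> M"
  shows "exp (a z u - cnj (a z u)) = cis u * exp (b (z, u, v) - cnj (b (z, u, v)))"
    and "exp (a z u + cnj (a z u)) = exp (b (z, u, v) + cnj (b (z, u, v)))"
    and "exp (- a z u - cnj (a z u)) = exp (- b (z, u, v) - cnj (b (z, u, v)))"
    and "exp (- a z u - 3 * cnj (a z u)) = cis u * exp (- b (z, u, v) - 3 * cnj (b (z, u, v)))"
  using assms by (simp_all add: a_eq b_def cis_conv_exp flip: exp_add)

text \<open>The phase \<open>cis u\<close> of the exponential cancels the conjugate phase of
  \<open>pd_hol a\<close>, which is why \<open>u\<close> enters only through
  \<open>b\<close>.\<close>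

lemma alpha_eq:
  assumes "q \<in> M"
  shows "alpha a q = exp (b q - cnj (b q)) / cnj (H1 (b q))"
proof -
  obtain z u v where q: "q = (z, u, v)" by (cases q)
  have "cis u * cis (- u) = 1" by (simp add: cis_mult)
  then show ?thesis
    using assms by (simp add: alpha_def q exp_a pd_hol_a cis_cnj)
qed

text \<open>The formula is wanted on a neighbourhood of \<open>u\<close>, not just at
  \<open>u\<close>, because it is differentiated once more for \<open>nu\<close>.\<close>

lemma pd_u_Z:
  assumes q: "(z, u, v) \<in> M"
  shows "\<forall>\<^sub>F t in nhds u. pd_u Z (a z u) t = cis (- t) *
    (- \<i> * (H (a z u - \<i> * of_real t / 2) + H1 (a z u - \<i> * of_real t / 2) / 2))"
proof -
  have "open ((\<lambda>t. a z u - \<i> * complex_of_real t / 2) -` T)"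
    by (intro open_vimage open_T continuous_intros) auto
  moreover have "a z u - \<i> * of_real u / 2 \<in> T" using a_u[OF q] b_in[OF q] by simp
  ultimately have "\<forall>\<^sub>F t in nhds u. a z u - \<i> * of_real t / 2 \<in> T"
    using eventually_nhds_in_open by fastforce
  \<comment> \<open>\<open>eventually_eventually\<close> upgrades the equation for \<open>Z\<close>
    near \<open>u\<close> to one that holds near each nearby \<open>t\<close>, as differentiation at
    \<open>t\<close> requires.\<close>
  moreover have "\<forall>\<^sub>F t in nhds u. \<forall>\<^sub>F r in nhds t.
      Z (a z u) r = cis (- r) * H (a z u - \<i> * of_real r / 2)"
    using Z_eq[OF q] by (simp add: eventually_eventually)
  ultimately show ?thesis
  proof eventually_elim
    case (elim t)
    have "(Z (a z u) has_vector_derivative - \<i> * cis (- t) * (H (a z u - \<i> * of_real t / 2) +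
        H1 (a z u - \<i> * of_real t / 2) / 2)) (at t)"
      using has_vector_derivative_cis_mult_holomorphic[OF H_hol open_T elim(1)]
      by (subst has_vector_derivative_cong_ev[where g =
            "\<lambda>r. cis (- r) * H (a z u - \<i> * of_real r / 2)"])
        (use elim(2) in \<open>auto elim: eventually_mono dest: eventually_nhds_x_imp_x\<close>)
    then show ?case by (simp add: pd_u_def vector_derivative_at)
  qed
qed

text \<open>Second application of the operator that sends \<open>G\<close> to
  \<open>- \<i> * (G + G' / 2)\<close>; its square sends \<open>G\<close> to
  \<open>- (G + G' + G'' / 4)\<close>.\<close>

lemma pd_u_pd_u_Z:
  assumes q: "(z, u, v) \<in> M"
  shows "pd_u (pd_u Z) (a z u) u = - cis (- u) *
    (H (b (z, u, v)) + H1 (b (z, u, v)) + H2 (b (z, u, v)) / 4)"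
proof -
  let ?b = "b (z, u, v)"
  let ?G = "\<lambda>w. - \<i> * (H w + H1 w / 2)"
  have G: "?G holomorphic_on T"
    by (intro holomorphic_intros H_hol H1_hol) auto
  have dG: "deriv ?G ?b = - \<i> * (H1 ?b + H2 ?b / 2)"
    by (rule DERIV_imp_deriv) (auto intro!: derivative_eq_intros
        holomorphic_derivI[OF H_hol open_T b_in[OF q]] holomorphic_derivI[OF H1_hol open_T b_in[OF q]])
  have "((\<lambda>t. cis (- t) * ?G (a z u - \<i> * of_real t / 2)) has_vector_derivative
      - \<i> * cis (- u) * (?G ?b + deriv ?G ?b / 2)) (at u)"
    using has_vector_derivative_cis_mult_holomorphic[OF G open_T] b_in[OF q]
    by (simp only: a_u[OF q, symmetric])
  then have "(pd_u Z (a z u) has_vector_derivative - \<i> * cis (- u) * (?G ?b + deriv ?G ?b / 2)) (at u)"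
    by (subst has_vector_derivative_cong_ev[where g =
          "\<lambda>t. cis (- t) * ?G (a z u - \<i> * of_real t / 2)"])
       (use pd_u_Z[OF q] in \<open>auto elim: eventually_mono dest: eventually_nhds_x_imp_x\<close>)
  then have "pd_u (pd_u Z) (a z u) u = - \<i> * cis (- u) * (?G ?b + deriv ?G ?b / 2)"
    by (simp add: pd_u_def vector_derivative_at)
  also have "\<dots> = - cis (- u) * (H ?b + H1 ?b + H2 ?b / 4)"
    unfolding dG by (simp add: algebra_simps add_divide_distrib diff_divide_distrib)
  finally show ?thesis .
qed

text \<open>\<open>pd_u L\<close> is the logarithmic derivative of
  \<open>cis (- t) * H1 (a - \<i> * t / 2)\<close>, in which the phase cancels.\<close>

lemma mu_eq:
  assumes "q \<in> M"
  shows "mu a L q = - \<i> * exp (- b q - cnj (b q)) * (1 + H2 (b q) / (2 * H1 (b q)))"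
proof -
  obtain z u v where q: "q = (z, u, v)" by (cases q)
  with assms have m: "(z, u, v) \<in> M" by simp
  have "a z u - \<i> * of_real u / 2 \<in> T" using a_u[OF m] b_in[OF m] by simp
  from has_vector_derivative_continuous_log[OF L_cont[OF m] L_eq[OF m]
      has_vector_derivative_cis_mult_holomorphic[OF H1_hol open_T this]]
  have "pd_u L (a z u) u = - \<i> * (1 + H2 (b q) / (2 * H1 (b q)))"
    using H1_nz[OF assms]
    by (simp add: a_u[OF m] q pd_u_def vector_derivative_at field_simps)
  moreover have "- a z u - cnj (a z u) = - b q - cnj (b q)"
    using m by (simp add: a_eq b_def q)
  ultimately show ?thesis by (simp add: mu_def q)
qed

text \<open>Both \<open>pd_u (pd_u Z)\<close> and the conjugate of \<open>pd_hol f\<close> carry the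
  factor \<open>cis (- u)\<close>, which the phase of the prefactor removes. Apart from
  \<open>cnj (g u)\<close>, only \<open>b\<close> remains.\<close>

lemma nu_eq:
  assumes "q = (z, u, v)" "q \<in> M"
  shows "nu f a Z q = exp (- b q - 3 * cnj (b q)) *
    (- (H (b q) + H1 (b q) + H2 (b q) / 4) + cnj (deriv F (H (b q))) + cnj (g u))"
proof -
  let ?E = "exp (- b q - 3 * cnj (b q))" and ?K = "H (b q) + H1 (b q) + H2 (b q) / 4"
  have "H (b q) = cis u * z" using assms by (simp add: b_def H_h M_S)
  then have "nu f a Z q = cis u * ?E * (- cis (- u) * ?K + cnj (cis u * (deriv F (H (b q)) + g u)))"
    using assms by (simp add: nu_def pd_u_pd_u_Z exp_a f_deriv)
  also have "\<dots> = (cis u * cis (- u)) * (?E * (- ?K + cnj (deriv F (H (b q))) + cnj (g u)))"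
    by (simp add: cis_cnj ring_distribs mult.assoc mult.left_commute)
  finally show ?thesis by (simp add: cis_mult)
qed

section \<open>Differentials and derivatives along the frame\<close>

lemma b_has_derivative:
  assumes "q \<in> M"
  shows "(b has_derivative db q) (at q)"
proof -
  obtain z u v where q: "q = (z, u, v)" by (cases q)
  have s: "cis u * z \<in> S" using assms q M_S by simp
  have "((\<lambda>p. \<i> * of_real (fst (snd p))) has_derivative (\<lambda>x. \<i> * of_real (fst (snd x)))) (at q)"
    by (auto intro!: derivative_eq_intros)
  from has_derivative_mult[OF has_derivative_exp_compose[OF this] has_derivative_fst[OF has_derivative_ident]]
  have inner: "((\<lambda>p. cis (fst (snd p)) * fst p) has_derivative
      (\<lambda>x. cis u * (fst x + \<i> * z * of_real (fst (snd x))))) (at q)"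
    by (simp add: q cis_conv_exp algebra_simps)
  have "(h has_field_derivative deriv h (cis u * z)) (at (cis (fst (snd q)) * fst q))"
    using holomorphic_derivI[OF h_hol open_S s] by (simp add: q)
  from has_derivative_field_compose[OF inner this]
  have "(b has_derivative (\<lambda>x. deriv h (cis u * z) *
      (cis u * (fst x + \<i> * z * of_real (fst (snd x)))))) (at q)"
    by (simp add: b_def case_prod_unfold)
  moreover have "deriv h (cis u * z) = 1 / H1 (h (cis u * z))"
    using H1_h[OF s] H1_nz[OF assms] by (simp add: q b_def field_simps)
  ultimately show ?thesis
    by (elim has_derivative_eq_rhs) (auto simp: db_def q fun_eq_iff)
qed

lemma has_derivative_comp_b:
  assumes "\<Phi> holomorphic_on T" "q \<in> M"
  shows "((\<lambda>p. \<Phi> (b p)) has_derivative (\<lambda>x. deriv \<Phi> (b q) * db q x)) (at q)"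
  by (rule has_derivative_field_compose[OF b_has_derivative[OF assms(2)]
        holomorphic_derivI[OF assms(1) open_T b_in[OF assms(2)]]])

lemma has_derivative_on_M:
  assumes "q \<in> M" "(Q has_derivative Q') (at q)" "\<And>p. p \<in> M \<Longrightarrow> Q p = R p"
  shows "(R has_derivative Q') (at q)"
  using assms has_derivative_transform_within_open open_M by blast

text \<open>The closed form of \<open>inv_A\<close>, being the ratio of the two coefficients in the
  differential of \<open>alpha\<close>; \<open>inv_A_eq\<close> identifies the two.\<close>

definition A :: "point \<Rightarrow> complex" where
  "A q = - (1 + cnj (H2 (b q) / H1 (b q)))"

lemma alpha_has_derivative:
  assumes q: "q \<in> M"
  shows "(alpha a has_derivative (\<lambda>x. alpha a q * db q x + alpha a q * A q * cnj (db q x))) (at q)"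
proof -
  have nz: "cnj (H1 (b q)) \<noteq> 0" using H1_nz[OF q] by simp
  have "((\<lambda>p. exp (b p - cnj (b p)) / cnj (H1 (b p))) has_derivative
      (\<lambda>x. alpha a q * db q x + alpha a q * A q * cnj (db q x))) (at q)"
    using has_derivative_divide'[OF has_derivative_exp_compose[OF has_derivative_diff[OF
          b_has_derivative[OF q] has_derivative_cnj[OF b_has_derivative[OF q]]]]
        has_derivative_cnj[OF has_derivative_comp_b[OF H1_hol q]] nz]
    by (rule has_derivative_eq_rhs) (use nz in \<open>simp add: fun_eq_iff alpha_eq[OF q] A_def field_simps\<close>)
  from has_derivative_on_M[OF q this] show ?thesis by (simp add: alpha_eq)
qed

text \<open>Since \<open>b = a - \<i> * u / 2\<close>, this form is \<open>da\<close>, which is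
  \<open>cnj alpha\<close> times \<open>omega1\<close>, minus \<open>\<i> / 2\<close> times
  \<open>du\<close>, and \<open>du\<close> is a multiple of \<open>omega3\<close>. In the
  computation the \<open>\<i> / 2\<close> comes from the \<open>H1 / 2\<close> term of
  \<open>pd_u Z\<close>.\<close>

lemma db_coframe:
  assumes q: "q \<in> M"
  shows "db q x = cnj (alpha a q) * omega1 a Z q x
    - \<i> / 2 * exp (- b q - cnj (b q)) * omega3 a q x"
proof -
  obtain z u v where z: "q = (z, u, v)" by (cases q)
  obtain dz du dv where x: "x = (dz, du, dv)" by (cases x)
  have m: "(z, u, v) \<in> M" using q z by simp
  have e: "exp (cnj (b q) - b q) * exp (b q - cnj (b q)) = 1"
    "exp (- b q - cnj (b q)) * exp (b q + cnj (b q)) = 1" by (simp_all flip: exp_add)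
  have nz: "H1 (b q) \<noteq> 0" using H1_nz[OF q] .
  have Hb: "H (b q) = cis u * z" using m by (simp add: b_def z H_h M_S)
  have cc: "cis u * cis (- u) = 1" by (simp add: cis_mult)
  have Zu: "pd_u Z (a z u) u = cis (- u) * (- \<i> * (cis u * z + H1 (b q) / 2))"
    using eventually_nhds_x_imp_x[OF pd_u_Z[OF m]] a_u[OF m] z Hb by simp
  have al: "cnj (alpha a q) = exp (cnj (b q) - b q) / H1 (b q)"
    by (simp add: alpha_eq[OF q] exp_cnj)
  have om: "omega1 a Z q x = cis u * exp (b q - cnj (b q)) *
      (dz - cis (- u) * (- \<i> * (cis u * z + H1 (b q) / 2)) * of_real du)"
    using m by (simp add: omega1_def z x exp_a Zu)
  have "cnj (alpha a q) * omega1 a Z q x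
      = (exp (cnj (b q) - b q) * exp (b q - cnj (b q))) / H1 (b q) * (cis u *
          (dz - cis (- u) * (- \<i> * (cis u * z + H1 (b q) / 2)) * of_real du))"
    unfolding al om by simp
  also have "\<dots> = (cis u * dz + (cis u * cis (- u)) * \<i> * (cis u * z + H1 (b q) / 2) * of_real du)
      / H1 (b q)"
    unfolding e using nz by (simp add: field_simps)
  also have "\<dots> = cis u * (dz + \<i> * z * of_real du) / H1 (b q) + \<i> / 2 * of_real du"
    unfolding cc using nz by (simp add: field_simps)
  finally have 1: "cnj (alpha a q) * omega1 a Z q x = db q x + \<i> / 2 * of_real du"
    by (simp add: db_def z x b_def)
  have "exp (- b q - cnj (b q)) * omega3 a q x
      = (exp (- b q - cnj (b q)) * exp (b q + cnj (b q))) * of_real du"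
    using m by (simp add: omega3_def z x exp_a)
  also have "\<dots> = of_real du" unfolding e by simp
  finally have "exp (- b q - cnj (b q)) * omega3 a q x = of_real du" .
  with 1 show ?thesis by (simp add: mult.assoc)
qed

lemma omega3_eq: "q \<in> M \<Longrightarrow> of_real (fst (snd x)) = exp (- b q - cnj (b q)) * omega3 a q x"
  by (cases q; cases x) (auto simp: omega3_def exp_a simp flip: exp_add mult.assoc)

text \<open>Inserting \<open>db_coframe\<close> and \<open>omega3_eq\<close> expands the
  differential in the coframe, and by \<open>coframe_basis\<close> the definite description can pick
  no other coefficients. In the third entry, \<open>c1\<close> and \<open>c2\<close> come from the
  \<open>omega3\<close> parts of \<open>db\<close> and its conjugate.\<close>

lemma frame_derivs_eq:
  assumes q: "q \<in> M" and Q: "(Q has_derivative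
    (\<lambda>x. c1 * db q x + c2 * cnj (db q x) + c3 * of_real (fst (snd x)))) (at q)"
  shows "frame_derivs f a Z Q q = (c1 * cnj (alpha a q), c2 * alpha a q,
    exp (- b q - cnj (b q)) * (c3 - \<i> / 2 * c1 + \<i> / 2 * c2), 0)"
proof -
  let ?T = "\<lambda>x. c1 * db q x + c2 * cnj (db q x) + c3 * of_real (fst (snd x))"
  let ?e = "exp (- b q - cnj (b q))"
  have T: "differential Q q = ?T"
    unfolding differential_def by (rule frechet_derivative_at[OF Q, symmetric])
  have cnj_w3: "cnj (omega3 a q x) = omega3 a q x" for x
    by (cases q; cases x) (simp add: omega3_def exp_cnj add.commute)
  have cnj_e: "cnj ?e = ?e" by (rule cnj_exp_real)
  have "?T x = (c1 * cnj (alpha a q)) * omega1 a Z q x + (c2 * alpha a q) * omega2 a Z q x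
      + ?e * (c3 - \<i> / 2 * c1 + \<i> / 2 * c2) * omega3 a q x + 0 * omega4 f a Z q x" for x
    unfolding omega3_eq[OF q] db_coframe[OF q] omega2_def
    by (simp add: cnj_w3 cnj_e del: exp_cnj) (simp add: algebra_simps)
  then show ?thesis
    using coframe_basis[OF has_derivative_linear[OF Q], of a Z q f]
    unfolding frame_derivs_def T by (intro the1_equality) simp_all
qed

section \<open>The scalar invariants\<close>

lemma inv_A_eq:
  assumes q: "q \<in> M"
  shows "inv_A f a Z q = A q"
proof -
  have "alpha a q \<noteq> 0" using H1_nz[OF q] by (simp add: alpha_eq[OF q])
  moreover have "frame_derivs f a Z (alpha a) q = (alpha a q * cnj (alpha a q),
      alpha a q * A q * alpha a q,
      exp (- b q - cnj (b q)) * (0 - \<i> / 2 * alpha a q + \<i> / 2 * (alpha a q * A q)), 0)"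
    by (rule frame_derivs_eq[OF q]) (use alpha_has_derivative[OF q] in simp)
  ultimately show ?thesis
    by (simp add: inv_A_def delta_star_def power2_eq_square)
qed

text \<open>Let \<open>r = H2 / H1\<close>. Then \<open>A = - (1 + cnj r)\<close> and
  \<open>mu = - \<i> * E * (1 + r / 2)\<close>, so \<open>A * cnj A - 1\<close> and
  \<open>mu * A - cnj mu\<close> are both multiples of \<open>r + cnj r + r * cnj r\<close>, and
  \<open>r\<close> cancels from the quotient.\<close>

lemma inv_X_eq:
  assumes q: "q \<in> M" and "inv_A f a Z q * cnj (inv_A f a Z q) \<noteq> 1"
  shows "inv_X f a Z L q = \<i> / 2 * exp (- b q - cnj (b q))"
proof -
  define r where "r = H2 (b q) / H1 (b q)"
  define E where "E = exp (- b q - cnj (b q))"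
  have A: "inv_A f a Z q = - (1 + cnj r)" using inv_A_eq[OF q] by (simp add: A_def r_def)
  have m: "mu a L q = - \<i> * E * (1 + r / 2)"
    using mu_eq[OF q] by (simp add: E_def r_def)
  have "cnj E = E" by (simp add: E_def cnj_exp_real)
  then have "inv_B f a Z L q = \<i> / 2 * E * (inv_A f a Z q * cnj (inv_A f a Z q) - 1)"
    unfolding inv_B_def m A by (simp add: field_simps)
  then show ?thesis using assms(2) by (simp add: inv_X_def E_def)
qed

text \<open>With \<open>X\<close> known, the correction added to \<open>nu\<close> is the common
  exponential times \<open>H1 + H2 / 4\<close>. It removes exactly what \<open>pd_u (pd_u Z)\<close>
  contributed beyond \<open>H\<close>.\<close>

lemma nu_hat_eq:
  assumes "q = (z, u, v)" and q: "q \<in> M" and "inv_A f a Z q * cnj (inv_A f a Z q) \<noteq> 1"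
  shows "nu_hat f a Z L q = exp (- b q - 3 * cnj (b q)) *
    (- H (b q) + cnj (deriv F (H (b q))) + cnj (g u))"
proof -
  define E where "E = exp (- b q - cnj (b q))"
  define r where "r = H2 (b q) / H1 (b q)"
  have nz: "H1 (b q) \<noteq> 0" using H1_nz[OF q] .
  have cE: "cnj E = E" by (simp add: E_def cnj_exp_real)
  have EE: "E * E * exp (b q - cnj (b q)) = exp (- b q - 3 * cnj (b q))"
    by (simp add: E_def flip: exp_add)
  have X: "inv_X f a Z L q = \<i> / 2 * E" using inv_X_eq[OF q assms(3)] by (simp add: E_def)
  have m: "mu a L q = - \<i> * E * (1 + r / 2)"
    using mu_eq[OF q] by (simp add: E_def r_def field_simps)
  have al: "1 / cnj (alpha a q) = exp (b q - cnj (b q)) * H1 (b q)"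
    using nz by (simp add: alpha_eq[OF q] exp_cnj exp_diff field_simps)
  have "inv_X f a Z L q * (mu a L q + 2 * cnj (inv_X f a Z L q)) / cnj (alpha a q)
      = (1 / cnj (alpha a q)) * E * E * (1 + r / 4)"
    unfolding X m by (simp add: cE algebra_simps)
  also have "\<dots> = (E * E * exp (b q - cnj (b q))) * (H1 (b q) + H2 (b q) / 4)"
    unfolding al using nz by (simp add: r_def field_simps)
  finally have "inv_X f a Z L q * (mu a L q + 2 * cnj (inv_X f a Z L q)) / cnj (alpha a q)
      = exp (- b q - 3 * cnj (b q)) * (H1 (b q) + H2 (b q) / 4)" unfolding EE .
  then show ?thesis
    unfolding nu_hat_def nu_eq[OF assms(1) q] by (simp add: algebra_simps)
qed

lemma holomorphic_deriv_F_H: "(\<lambda>w. deriv F (H w)) holomorphic_on T"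
  using holomorphic_on_compose_gen[OF H_hol holomorphic_deriv[OF F_hol open_S]] H_in
  by (auto simp: o_def)

text \<open>By \<open>exp_h\<close> the second derivative of \<open>F\<close> at
  \<open>H (b q)\<close> is \<open>exp (4 * b q)\<close>; the rest is the chain rule. This relation
  later makes the term \<open>1 / alpha\<close> cancel.\<close>

lemma deriv_deriv_F_H:
  assumes "q \<in> M"
  shows "deriv (\<lambda>w. deriv F (H w)) (b q) = exp (4 * b q) * H1 (b q)"
proof -
  obtain z u v where q: "q = (z, u, v)" by (cases q)
  have s: "cis u * z \<in> S" using assms q M_S by simp
  have bq: "b q = h (cis u * z)" by (simp add: b_def q)
  have Hb: "H (b q) = cis u * z" by (simp add: bq H_h s)
  have "(deriv F has_field_derivative deriv (deriv F) (H (b q))) (at (H (b q)))"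
    using holomorphic_derivI[OF holomorphic_deriv[OF F_hol open_S] open_S] s by (simp add: Hb)
  from DERIV_chain2[OF this holomorphic_derivI[OF H_hol open_T b_in[OF assms]]]
  have "((\<lambda>w. deriv F (H w)) has_field_derivative deriv (deriv F) (H (b q)) * H1 (b q)) (at (b q))" .
  then show ?thesis using exp_h[OF s] Hb bq by (simp add: DERIV_imp_deriv)
qed

lemma has_derivative_cnj_g:
  fixes q :: point
  assumes "(g has_vector_derivative g') (at (fst (snd q)))"
  shows "((\<lambda>p. cnj (g (fst (snd p)))) has_derivative (\<lambda>x. cnj g' * of_real (fst (snd x)))) (at q)"
proof -
  have "((\<lambda>p::point. fst (snd p)) has_derivative (\<lambda>x. fst (snd x))) (at q)"
    by (auto intro!: derivative_eq_intros)
  from has_derivative_cnj[OF has_derivative_compose[OF this assms[unfolded has_vector_derivative_def]]]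
  show ?thesis by (simp add: scaleR_conv_of_real mult.commute)
qed

text \<open>\<open>Delta\<close> of the quotient yields the \<open>g'\<close> term, an
  \<open>H1\<close> term, twice \<open>nu_hat\<close>, and minus \<open>1 / alpha\<close>; the other
  summands of the definition cancel all but the first. The condition on \<open>A\<close> is imposed
  on all of \<open>M\<close> because the quotient gets differentiated.\<close>

lemma Upsilon_hat_eq:
  assumes q: "(z, u, v) \<in> M" and AA: "\<And>p. p \<in> M \<Longrightarrow> inv_A f a Z p * cnj (inv_A f a Z p) \<noteq> 1"
    and g': "(g has_vector_derivative g') (at u)"
  shows "Upsilon_hat f a Z L (z, u, v) = 2 * \<i> * exp (- b (z, u, v) - 3 * cnj (b (z, u, v))) * cnj g'"
proof -
  define q where "q = (z, u, v)"
  have qM: "q \<in> M" using q by (simp add: q_def)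
  have qu: "fst (snd q) = u" by (simp add: q_def)
  then have gq: "(g has_vector_derivative g') (at (fst (snd q)))" using g' by simp
  define E W where "E = exp (- b q - cnj (b q))" and "W = exp (- b q - 3 * cnj (b q))"
  define e2 N where "e2 = exp (- 2 * cnj (b q))"
    and "N = - H (b q) + cnj (deriv F (H (b q))) + cnj (g u)"
  have exps: "E * e2 = W" "W * exp (4 * cnj (b q)) = exp (cnj (b q) - b q)"
    "E * E * exp (b q - cnj (b q)) = W"
    by (simp_all add: E_def e2_def W_def flip: exp_add) (simp add: minus_diff_commute)
  have cE: "cnj E = E" by (simp add: E_def cnj_exp_real)
  then have E: "of_real (Re E) = E" by (simp add: complex_eq_iff)
  have nz: "H1 (b q) \<noteq> 0" using H1_nz[OF qM] .
  \<comment> \<open>Dividing by the conjugate of \<open>X\<close> strips off the real factor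
    \<open>exp (- b - cnj b)\<close>, which leaves an explicit expression to differentiate.\<close>
  have quot: "2 * \<i> * exp (- 2 * cnj (b p)) *
      (- H (b p) + cnj (deriv F (H (b p))) + cnj (g (fst (snd p))))
      = nu_hat f a Z L p / cnj (inv_X f a Z L p)" if p: "p \<in> M" for p
  proof -
    obtain y t w where pp: "p = (y, t, w)" by (cases p)
    let ?E = "exp (- b p - cnj (b p))"
    have "exp (- b p - 3 * cnj (b p)) = exp (- 2 * cnj (b p)) * ?E"
      by (simp flip: exp_add) (simp add: minus_diff_commute)
    then have "nu_hat f a Z L p = exp (- 2 * cnj (b p)) * ?E *
        (- H (b p) + cnj (deriv F (H (b p))) + cnj (g t))"
      using nu_hat_eq[OF pp p AA[OF p]] by simp
    moreover have "cnj (inv_X f a Z L p) = - \<i> / 2 * ?E"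
      unfolding inv_X_eq[OF p AA[OF p]] by (simp add: cnj_exp_real del: exp_cnj)
    moreover have "2 * \<i> * e * n = (e * y * n) / (- \<i> / 2 * y)" if "y \<noteq> 0" for e n y :: complex
      using that by (simp add: field_simps)
    ultimately show ?thesis by (simp add: pp)
  qed
  have "((\<lambda>p. 2 * \<i> * exp (- 2 * cnj (b p)) *
      (- H (b p) + cnj (deriv F (H (b p))) + cnj (g (fst (snd p))))) has_derivative
      (\<lambda>x. (- 2 * \<i> * e2 * H1 (b q)) * db q x
        + (2 * \<i> * e2 * (cnj (exp (4 * b q) * H1 (b q)) - 2 * N)) * cnj (db q x)
        + (2 * \<i> * e2 * cnj g') * of_real (fst (snd x)))) (at q)"
    using has_derivative_mult[OF has_derivative_mult_right[where x = "2 * \<i>", OF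
        has_derivative_exp_compose[OF has_derivative_mult_right[where x = "- 2", OF
            has_derivative_cnj[OF b_has_derivative[OF qM]]]]]
        has_derivative_add[OF has_derivative_add[OF
          has_derivative_minus[OF has_derivative_comp_b[OF H_hol qM]]
          has_derivative_cnj[OF has_derivative_comp_b[OF holomorphic_deriv_F_H qM]]]
        has_derivative_cnj_g[OF gq]]]
    by (rule has_derivative_eq_rhs)
      (simp add: fun_eq_iff deriv_deriv_F_H[OF qM] e2_def N_def qu algebra_simps)
  from frame_derivs_eq[OF qM has_derivative_on_M[OF qM this quot]]
  have "Delta f a Z (\<lambda>p. nu_hat f a Z L p / cnj (inv_X f a Z L p)) q
      = E * (2 * \<i> * e2 * cnj g' - \<i> / 2 * (- 2 * \<i> * e2 * H1 (b q))
        + \<i> / 2 * (2 * \<i> * e2 * (cnj (exp (4 * b q) * H1 (b q)) - 2 * N)))"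
    by (simp add: Delta_def E_def)
  also have "\<dots> = (E * e2) * (2 * \<i> * cnj g' - H1 (b q) + 2 * N)
      - (E * e2) * exp (4 * cnj (b q)) * cnj (H1 (b q))"
    by (simp add: exp_cnj algebra_simps)
  also have "\<dots> = W * (2 * \<i> * cnj g' - H1 (b q) + 2 * N) - exp (cnj (b q) - b q) * cnj (H1 (b q))"
    unfolding exps ..
  finally have D: "Delta f a Z (\<lambda>p. nu_hat f a Z L p / cnj (inv_X f a Z L p)) q
      = W * (2 * \<i> * cnj g' - H1 (b q) + 2 * N) - exp (cnj (b q) - b q) * cnj (H1 (b q))" .
  have n: "nu_hat f a Z L q = W * N"
    using nu_hat_eq[OF q_def qM AA[OF qM]] by (simp add: W_def N_def)
  have al: "1 / alpha a q = exp (cnj (b q) - b q) * cnj (H1 (b q))"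
    "1 / cnj (alpha a q) = exp (b q - cnj (b q)) * H1 (b q)"
    using nz by (simp_all add: alpha_eq[OF qM] exp_cnj exp_diff field_simps)
  have X: "inv_X f a Z L q = \<i> / 2 * E"
    using inv_X_eq[OF qM AA[OF qM]] by (simp add: E_def)
  \<comment> \<open>\<open>E\<close> is real, so \<open>X\<close> is purely imaginary.\<close>
  have "of_real (Im (inv_X f a Z L q)) = E / 2"
    unfolding X by (simp add: E)
  then have "4 * \<i> * inv_X f a Z L q * of_real (Im (inv_X f a Z L q)) / cnj (alpha a q)
      = - (E * E) * (1 / cnj (alpha a q))"
    unfolding X by (simp add: field_simps)
  also have "\<dots> = - (E * E * exp (b q - cnj (b q))) * H1 (b q)" unfolding al by simp
  finally have last: "4 * \<i> * inv_X f a Z L q * of_real (Im (inv_X f a Z L q)) / cnj (alpha a q)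
      = - W * H1 (b q)" unfolding exps .
  have "Upsilon_hat f a Z L q = 2 * \<i> * W * cnj g'"
    unfolding Upsilon_hat_def D n al last by (simp add: algebra_simps)
  then show ?thesis by (simp add: q_def W_def)
qed

section \<open>The differential of \<open>nu\<close> and the wedge product\<close>

text \<open>Only the \<open>du\<close> coefficient is made explicit: \<open>n1\<close> and
  \<open>n2\<close> disappear after wedging with the differentials of \<open>alpha\<close> and its
  conjugate.\<close>

lemma nu_has_derivative:
  assumes q: "q \<in> M" and g': "(g has_vector_derivative g') (at (fst (snd q)))"
  obtains n1 n2 where "(nu f a Z has_derivative (\<lambda>x. n1 * db q x + n2 * cnj (db q x)
    + exp (- b q - 3 * cnj (b q)) * cnj g' * of_real (fst (snd x)))) (at q)"
proof -
  let ?K = "\<lambda>w. - (H w + H1 w + H2 w / 4)"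
  have K: "?K holomorphic_on T"
    by (intro holomorphic_intros H_hol H1_hol H2_hol) auto
  let ?dF = "\<lambda>w. deriv F (H w)" and ?W = "exp (- b q - 3 * cnj (b q))"
  let ?N = "?K (b q) + cnj (?dF (b q)) + cnj (g (fst (snd q)))"
  have "((\<lambda>p. exp (- b p - 3 * cnj (b p)) * (?K (b p) + cnj (?dF (b p)) + cnj (g (fst (snd p)))))
      has_derivative (\<lambda>x. ?W * (deriv ?K (b q) - ?N) * db q x
        + ?W * (cnj (deriv ?dF (b q)) - 3 * ?N) * cnj (db q x)
        + ?W * cnj g' * of_real (fst (snd x)))) (at q)"
    using has_derivative_mult[OF has_derivative_exp_compose[OF has_derivative_diff[OF
          has_derivative_minus[OF b_has_derivative[OF q]]
          has_derivative_mult_right[where x = 3, OF has_derivative_cnj[OF b_has_derivative[OF q]]]]]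
        has_derivative_add[OF has_derivative_add[OF has_derivative_comp_b[OF K q]
          has_derivative_cnj[OF has_derivative_comp_b[OF holomorphic_deriv_F_H q]]]
        has_derivative_cnj_g[OF g']]]
    by (rule has_derivative_eq_rhs) (simp add: fun_eq_iff ring_distribs mult_ac del: minus_add_distrib)
  then have "(nu f a Z has_derivative (\<lambda>x. ?W * (deriv ?K (b q) - ?N) * db q x
        + ?W * (cnj (deriv ?dF (b q)) - 3 * ?N) * cnj (db q x)
        + ?W * cnj g' * of_real (fst (snd x)))) (at q)"
    by (rule has_derivative_on_M[OF q]) (auto simp: nu_eq)
  then show thesis by (rule that)
qed

text \<open>In terms of \<open>db\<close> and its conjugate, the differentials of
  \<open>alpha\<close> and \<open>cnj alpha\<close> have determinant
  \<open>alpha * cnj alpha * (1 - A * cnj A)\<close>, nonzero by the condition on \<open>A\<close>.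
  The wedge is this determinant times \<open>cnj g'\<close>, an exponential and the form
  \<open>vol\<close>.\<close>

lemma wedge3_eq_0_iff:
  assumes q: "(z, u, v) \<in> M" and "inv_A f a Z (z, u, v) * cnj (inv_A f a Z (z, u, v)) \<noteq> 1"
    and g': "(g has_vector_derivative g') (at u)"
  shows "(\<forall>x y w. wedge3 (differential (alpha a) (z, u, v))
      (differential (\<lambda>q. cnj (alpha a q)) (z, u, v)) (differential (nu f a Z) (z, u, v)) x y w = 0)
    \<longleftrightarrow> g' = 0"
proof -
  define q where "q = (z, u, v)"
  have qM: "q \<in> M" using q by (simp add: q_def)
  let ?\<alpha> = "alpha a q" and ?W = "exp (- b q - 3 * cnj (b q))"
  have nz: "?\<alpha> \<noteq> 0" using H1_nz[OF qM] by (simp add: alpha_eq[OF qM])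
  have AA: "A q * cnj (A q) \<noteq> 1"
    using assms(2) inv_A_eq[OF qM] by (simp add: q_def)
  obtain n1 n2 where n: "(nu f a Z has_derivative (\<lambda>x. n1 * db q x + n2 * cnj (db q x)
      + ?W * cnj g' * of_real (fst (snd x)))) (at q)"
    by (rule nu_has_derivative[OF qM, of g']) (use g' in \<open>auto simp: q_def\<close>)
  have d\<nu>: "differential (nu f a Z) q = (\<lambda>x. n1 * db q x + n2 * cnj (db q x)
      + ?W * cnj g' * of_real (fst (snd x)))"
    unfolding differential_def by (rule frechet_derivative_at[OF n, symmetric])
  have d\<alpha>: "differential (alpha a) q = (\<lambda>x. ?\<alpha> * db q x + ?\<alpha> * A q * cnj (db q x))"
    unfolding differential_def by (rule frechet_derivative_at[OF alpha_has_derivative[OF qM], symmetric])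
  have d\<alpha>c: "differential (\<lambda>q. cnj (alpha a q)) q
      = (\<lambda>x. cnj ?\<alpha> * cnj (A q) * db q x + cnj ?\<alpha> * cnj (db q x))"
    unfolding differential_def
    using frechet_derivative_at[OF has_derivative_cnj[OF alpha_has_derivative[OF qM]], symmetric]
    by (simp add: add.commute)
  define vol where "vol = wedge3 (db q) (\<lambda>x. cnj (db q x)) (\<lambda>x. of_real (fst (snd x)))"
  have wedge: "wedge3 (differential (alpha a) q) (differential (\<lambda>q. cnj (alpha a q)) q)
      (differential (nu f a Z) q) x y w
      = ?W * cnj g' * (?\<alpha> * cnj ?\<alpha>) * (1 - A q * cnj (A q)) * vol x y w" for x y w
    unfolding d\<alpha> d\<alpha>c d\<nu> vol_def wedge3_combination by (simp add: algebra_simps)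
  \<comment> \<open>\<open>k\<close> normalises \<open>db (k, 0, 0)\<close> to 1. On
    \<open>(k, 0, 0)\<close>, \<open>(\<i> * k, 0, 0)\<close> and the \<open>u\<close>-direction,
    \<open>vol\<close> is then \<open>- 2 * \<i>\<close>, so it is not the zero form.\<close>
  define k where "k = H1 (b q) / cis u"
  have "db q (k, 0, 0) = 1" "db q (\<i> * k, 0, 0) = \<i>"
    using H1_nz[OF qM] by (simp_all add: db_def q_def k_def b_def)
  then have "vol (k, 0, 0) (\<i> * k, 0, 0) (0, 1, 0) = - 2 * \<i>"
    by (simp add: vol_def wedge3_def)
  then have "\<exists>x y w. vol x y w \<noteq> 0"
    by (intro exI[of _ "(k, 0, 0)"] exI[of _ "(\<i> * k, 0, 0)"] exI[of _ "(0, 1, 0)"]) simp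
  then show ?thesis
    unfolding q_def[symmetric] wedge using nz AA by auto
qed

end

section \<open>Slices of open domains and small logarithms of 1\<close>

lemma open_zu_dom:
  assumes "open D"
  shows "open (zu_dom D)"
proof -
  have "zu_dom D = (\<Union>v. (\<lambda>x. (fst x, snd x, v)) -` D)"
    by (force simp: zu_dom_def)
  also have "open \<dots>" by (intro open_UN ballI open_vimage assms continuous_intros)
  finally show ?thesis .
qed

lemma eventually_slice_fst:
  assumes "open E" "(z, u) \<in> E"
  shows "\<forall>\<^sub>F w in nhds z. (w, u) \<in> E"
proof -
  have "open ((\<lambda>w. (w, u)) -` E)" by (intro open_vimage assms continuous_intros)
  then show ?thesis using assms eventually_nhds_in_open by fastforce
qed

lemma eventually_slice_snd:
  assumes "open E" "(z, u) \<in> E"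
  shows "\<forall>\<^sub>F t in nhds u. (z, t) \<in> E"
proof -
  have "open ((\<lambda>t. (z, t)) -` E)" by (intro open_vimage assms continuous_intros)
  then show ?thesis using assms eventually_nhds_in_open by fastforce
qed

text \<open>Nonzero elements of the kernel of \<open>exp\<close> have norm at least
  \<open>2 * pi\<close>. This excludes a jump between branches when \<open>a\<close> is compared
  with its model.\<close>

lemma exp_eq_1_small:
  fixes w :: complex
  assumes "exp w = 1" "norm w < 1"
  shows "w = 0"
proof -
  have "\<bar>Im w\<bar> < pi" using abs_Im_le_cmod[of w] assms(2) pi_gt3 by linarith
  then have "Ln (exp w) = w" by (intro Ln_exp) auto
  then show ?thesis using assms(1) by simp
qed

section \<open>Potentials of the rotating form and the branch of \<open>a\<close>\<close>

context
  fixes E :: "(complex \<times> real) set" and f :: zufun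
    and F :: "complex \<Rightarrow> complex" and g :: "real \<Rightarrow> complex"
  assumes E: "open E" and F: "F analytic_on (\<lambda>(z, u). cis u * z) ` E"
    and f: "(z, u) \<in> E \<Longrightarrow> f z u = F (cis u * z) + g u * cis u * z"
begin

lemma pd_hol_rotating:
  assumes "(z, u) \<in> E"
  shows "pd_hol f z u = cis u * (deriv F (cis u * z) + g u)"
proof -
  have "F analytic_on {cis u * z}"
    using analytic_on_subset[OF F] assms by force
  then have "(F has_field_derivative deriv F (cis u * z)) (at (cis u * z))"
    using analytic_on_imp_differentiable_at DERIV_deriv_iff_field_differentiable by blast
  then have "((\<lambda>w. F (cis u * w) + g u * cis u * w) has_field_derivative
      deriv F (cis u * z) * cis u + g u * cis u) (at z)"
    by (auto intro!: derivative_eq_intros DERIV_chain2[where f = F])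
  then have "deriv (\<lambda>w. F (cis u * w) + g u * cis u * w) z = cis u * (deriv F (cis u * z) + g u)"
    by (simp add: DERIV_imp_deriv algebra_simps)
  moreover have "pd_hol f z u = deriv (\<lambda>w. F (cis u * w) + g u * cis u * w) z"
    unfolding pd_hol_def
    by (rule deriv_cong_ev)
      (auto intro: eventually_mono[OF eventually_slice_fst[OF E assms]] simp: f)
  ultimately show ?thesis by simp
qed

lemma pd_hol_pd_hol_rotating:
  assumes "(z, u) \<in> E"
  shows "pd_hol (pd_hol f) z u = cis u ^ 2 * deriv (deriv F) (cis u * z)"
proof -
  have "F analytic_on {cis u * z}"
    using analytic_on_subset[OF F] assms by force
  then have "(deriv F has_field_derivative deriv (deriv F) (cis u * z)) (at (cis u * z))"
    using analytic_on_imp_differentiable_at analytic_deriv DERIV_deriv_iff_field_differentiable by blast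
  then have "((\<lambda>w. cis u * (deriv F (cis u * w) + g u)) has_field_derivative
      cis u * (deriv (deriv F) (cis u * z) * cis u)) (at z)"
    by (auto intro!: derivative_eq_intros DERIV_chain2[where f = "deriv F"])
  then have "deriv (\<lambda>w. cis u * (deriv F (cis u * w) + g u)) z = cis u ^ 2 * deriv (deriv F) (cis u * z)"
    by (simp add: DERIV_imp_deriv power2_eq_square)
  moreover have "pd_hol (pd_hol f) z u = deriv (\<lambda>w. cis u * (deriv F (cis u * w) + g u)) z"
    unfolding pd_hol_def[of "pd_hol f"]
    by (rule deriv_cong_ev)
      (auto intro: eventually_mono[OF eventually_slice_fst[OF E assms]] simp: pd_hol_rotating)
  ultimately show ?thesis by simp
qed

text \<open>Regularity of \<open>g\<close> is recovered from that of \<open>f\<close>: at a point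
  with nonzero first coordinate the equation for \<open>f\<close> can be solved for
  \<open>g\<close>, and all other terms are differentiable in \<open>u\<close>.\<close>

lemma differentiable_coefficient:
  assumes diff: "\<And>z u. (z, u) \<in> E \<Longrightarrow> f z differentiable (at u)" and "(z, u) \<in> E"
  shows "g differentiable (at u)"
proof -
  have "open ((\<lambda>w. (w, u)) -` E)" by (intro open_vimage E continuous_intros)
  moreover have "z \<in> (\<lambda>w. (w, u)) -` E" using assms by simp
  \<comment> \<open>A nonempty open slice is not contained in \<open>{0}\<close>, so the first
    coordinate can be moved away from 0 before dividing by it.\<close>
  ultimately have "\<not> (\<lambda>w. (w, u)) -` E \<subseteq> {0}"
    using not_open_singleton[of "0::complex"] by (metis empty_iff subset_singletonD)
  then obtain y where y: "(y, u) \<in> E" "y \<noteq> 0" by blast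
  have "((\<lambda>t. \<i> * of_real t) has_vector_derivative \<i>) (at u)"
    by (auto intro!: derivative_eq_intros simp: has_vector_derivative_def scaleR_conv_of_real)
  from field_vector_diff_chain_at[OF this DERIV_exp]
  have "(cis has_vector_derivative \<i> * cis u) (at u)"
    by (simp add: o_def cis_conv_exp[abs_def])
  then have cis: "((\<lambda>t. cis t * y) has_vector_derivative \<i> * cis u * y) (at u)"
    by (rule has_vector_derivative_mult_left)
  have "F analytic_on {cis u * y}"
    using analytic_on_subset[OF F] y by force
  then have "(F has_field_derivative deriv F (cis u * y)) (at (cis u * y))"
    using analytic_on_imp_differentiable_at DERIV_deriv_iff_field_differentiable by blast
  from field_vector_diff_chain_at[OF cis this]
  have "(\<lambda>t. F (cis t * y)) differentiable (at u)"
    by (auto simp: o_def intro: differentiableI_vector)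
  moreover have "(\<lambda>t. cis t * y) differentiable (at u)"
    using cis by (rule differentiableI_vector)
  ultimately have "(\<lambda>t. (f y t - F (cis t * y)) / (cis t * y)) differentiable (at u)"
    using y by (intro differentiable_divide differentiable_diff diff) auto
  then obtain d where d: "((\<lambda>t. (f y t - F (cis t * y)) / (cis t * y)) has_vector_derivative d) (at u)"
    using vector_derivative_works by blast
  have "(f y t - F (cis t * y)) / (cis t * y) = g t" if "(y, t) \<in> E" for t
    using f[OF that] y by simp
  then have "(g has_vector_derivative d) (at u)"
    using d eventually_slice_snd[OF E y(1)] y
    by (subst (asm) has_vector_derivative_cong_ev[where g = g]) (auto elim: eventually_mono)
  then show ?thesis by (rule differentiableI_vector)
qed

text \<open>A holomorphic logarithm of \<open>F''\<close> near the base point gives \<open>h\<close>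
  up to a constant. Then \<open>a\<close> and \<open>\<i> * u / 2 + h\<close> are both continuous,
  become equal after multiplication by 4 and exponentiation, and agree at the base point, so they
  coincide nearby.\<close>

lemma local_branch:
  assumes a_cont: "continuous_on E (\<lambda>(z, u). a z u)"
    and exp_a: "\<And>z u. (z, u) \<in> E \<Longrightarrow> exp (4 * a z u) = pd_hol (pd_hol f) z u"
    and "(z0, u0) \<in> E"
  obtains h S E' where "open S" "cis u0 * z0 \<in> S" "h holomorphic_on S" "F holomorphic_on S"
    "\<And>s. s \<in> S \<Longrightarrow> exp (4 * h s) = deriv (deriv F) s"
    "open E'" "(z0, u0) \<in> E'" "E' \<subseteq> E"
    "\<And>z u. (z, u) \<in> E' \<Longrightarrow> cis u * z \<in> S"
    "\<And>z u. (z, u) \<in> E' \<Longrightarrow> a z u = \<i> * of_real u / 2 + h (cis u * z)"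
proof -
  define s0 where "s0 = cis u0 * z0"
  have "F analytic_on {s0}"
    using analytic_on_subset[OF F] assms(3) by (force simp: s0_def)
  then obtain r1 where r1: "r1 > 0" "F holomorphic_on ball s0 r1"
    by (auto simp: analytic_on_def)
  have F2: "deriv (deriv F) holomorphic_on ball s0 r1"
    by (intro holomorphic_deriv r1 open_ball)
  have "cis u0 ^ 2 * deriv (deriv F) s0 = exp (4 * a z0 u0)"
    using pd_hol_pd_hol_rotating[OF assms(3)] exp_a[OF assms(3)] by (simp add: s0_def)
  then have F2_s0: "deriv (deriv F) s0 \<noteq> 0" by (metis exp_not_eq_zero mult_zero_right)
  have "continuous (at s0) (deriv (deriv F))"
    using F2 r1 by (intro field_differentiable_imp_continuous_at
        holomorphic_on_imp_differentiable_at[of _ "ball s0 r1"]) auto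
  then obtain r2 where r2: "r2 > 0" "\<And>s. dist s0 s < r2 \<Longrightarrow> deriv (deriv F) s \<noteq> 0"
    using continuous_at_avoid[of s0 "deriv (deriv F)" 0] F2_s0 by blast
  define S where "S = ball s0 (min r1 r2)"
  have S: "open S" "convex S" "s0 \<in> S" "S \<subseteq> ball s0 r1" using r1 r2 by (auto simp: S_def)
  have "deriv (deriv F) s \<noteq> 0" if "s \<in> S" for s using that r2 by (simp add: S_def)
  from holomorphic_logarithm_exists[OF S(2,1) holomorphic_on_subset[OF F2 S(4)] this S(3)]
  obtain l where l: "l holomorphic_on S" "\<And>s. s \<in> S \<Longrightarrow> exp (l s) = deriv (deriv F) s" by blast
  \<comment> \<open>The additive constant makes \<open>a = \<i> * u / 2 + h\<close> exact at the
    base point; \<open>exp_h\<close> checks that \<open>h\<close> is still a quarter of a logarithm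
    of \<open>F''\<close>.\<close>
  define h where "h = (\<lambda>s. (l s - l s0) / 4 + (a z0 u0 - \<i> * of_real u0 / 2))"
  have hol: "h holomorphic_on S" unfolding h_def by (intro holomorphic_intros l) auto
  have cis2: "exp (2 * (\<i> * of_real u)) = cis u ^ 2" for u
    by (simp add: cis_conv_exp flip: exp_of_nat_mult)
  have exp_h: "exp (4 * h s) = deriv (deriv F) s" if "s \<in> S" for s
  proof -
    have "4 * h s = l s - l s0 + (4 * a z0 u0 - 2 * (\<i> * of_real u0))"
      by (simp add: h_def field_simps)
    then have "exp (4 * h s) = exp (l s) / exp (l s0) * (exp (4 * a z0 u0) / cis u0 ^ 2)"
      by (simp only: exp_add exp_diff cis2)
    then show ?thesis
      using \<open>cis u0 ^ 2 * deriv (deriv F) s0 = exp (4 * a z0 u0)\<close>[symmetric] F2_s0 that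
      by (simp add: l S)
  qed
  define E1 where "E1 = E \<inter> (\<lambda>x. cis (snd x) * fst x) -` S"
  \<comment> \<open>The discrepancy between \<open>a\<close> and its model. It vanishes at the base
    point, and \<open>exp (4 * \<phi>)\<close> is 1 on \<open>E1\<close>.\<close>
  define \<phi> where "\<phi> = (\<lambda>x. a (fst x) (snd x) - \<i> * of_real (snd x) / 2 - h (cis (snd x) * fst x))"
  have cis_cont: "continuous_on A (\<lambda>x. cis (snd x) * fst x)" for A :: "(complex \<times> real) set"
    unfolding cis_conv_exp by (intro continuous_intros)
  have E1: "open E1" unfolding E1_def
    by (intro open_Int E open_vimage S cis_cont)
  have "continuous_on E1 (\<lambda>x. h (cis (snd x) * fst x))"
    by (rule continuous_on_compose2[OF holomorphic_on_imp_continuous_on[OF hol] cis_cont])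
      (auto simp: E1_def)
  moreover have "continuous_on E1 (\<lambda>x. a (fst x) (snd x))"
    using continuous_on_subset[OF a_cont, of E1] by (auto simp: E1_def case_prod_unfold)
  ultimately have \<phi>: "continuous_on E1 \<phi>"
    unfolding \<phi>_def by (intro continuous_intros) auto
  \<comment> \<open>Radius \<open>1/4\<close> keeps the norm of \<open>4 * \<phi>\<close> below 1,
    as \<open>exp_eq_1_small\<close> demands.\<close>
  define E' where "E' = E1 \<inter> \<phi> -` ball 0 (1/4)"
  have "open E'" unfolding E'_def
    by (rule continuous_open_preimage[OF \<phi> E1 open_ball])
  moreover have "(z0, u0) \<in> E'"
    using assms(3) S by (simp add: E'_def E1_def \<phi>_def h_def s0_def)
  moreover have "a z u = \<i> * of_real u / 2 + h (cis u * z)" if "(z, u) \<in> E'" for z u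
  proof -
    have zu: "(z, u) \<in> E" "cis u * z \<in> S" "norm (4 * \<phi> (z, u)) < 1"
      using that by (auto simp: E'_def E1_def norm_mult)
    have "4 * \<phi> (z, u) = 4 * a z u - 2 * (\<i> * of_real u) - 4 * h (cis u * z)"
      by (simp add: \<phi>_def field_simps)
    then have "exp (4 * \<phi> (z, u)) = exp (4 * a z u) / cis u ^ 2 / exp (4 * h (cis u * z))"
      by (simp only: exp_diff cis2)
    also have "\<dots> = 1"
      using exp_h[OF zu(2)] exp_not_eq_zero[of "4 * h (cis u * z)"]
      by (simp add: exp_a[OF zu(1)] pd_hol_pd_hol_rotating[OF zu(1)])
    finally have "4 * \<phi> (z, u) = 0" using zu(3) by (rule exp_eq_1_small)
    then have "\<phi> (z, u) = 0" by simp
    then show ?thesis by (simp add: \<phi>_def algebra_simps)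
  qed
  ultimately show thesis
    using that[of S h E'] S hol exp_h holomorphic_on_subset[OF r1(2) S(4)]
    by (auto simp: s0_def E'_def E1_def)
qed

end

section \<open>Existence of a chart around each point\<close>

lemma rotating_chart_exists:
  assumes wave: "vacuum_pp_wave D f" and adapted: "adapted_functions D f a Z L"
    and F: "F analytic_on ((\<lambda>(\<zeta>, u, v). cis u * \<zeta>) ` D)"
    and f: "\<forall>(\<zeta>, u, v) \<in> D. f \<zeta> u = F (cis u * \<zeta>) + g u * cis u * \<zeta>"
    and p: "p \<in> D" "alpha a p \<noteq> 0"
  obtains h H S T M where "rotating_chart f a Z L F g h H S T M" "p \<in> M" "M \<subseteq> D"
proof -
  obtain z0 u0 v0 where p0: "p = (z0, u0, v0)" by (cases p)
  define E where "E = zu_dom D"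
  define W where "W = (\<lambda>(z, u). (a z u, u)) ` E"
  have D_E: "(z, u) \<in> E" if "(z, u, v) \<in> D" for z u v
    using that by (force simp: E_def zu_dom_def)
  then have z0: "(z0, u0) \<in> E" using p p0 by blast
  have E: "open E" using wave unfolding E_def by (intro open_zu_dom) (simp add: vacuum_pp_wave_def)
  have F_E: "F analytic_on (\<lambda>(z, u). cis u * z) ` E"
    by (rule analytic_on_subset[OF F]) (force simp: E_def zu_dom_def)
  have f_E: "f z u = F (cis u * z) + g u * cis u * z" if "(z, u) \<in> E" for z u
    using that f by (force simp: E_def zu_dom_def)
  have f_diff: "f z differentiable (at u)" if "(z, u) \<in> E" for z u
  proof -
    have "\<forall>(z, u) \<in> E. (pd_u ^^ 0) f z differentiable (at u)"
      using wave unfolding vacuum_pp_wave_def smooth_in_u_def E_def by blast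
    then show ?thesis using that by auto
  qed
  have a_cont: "continuous_on E (\<lambda>(z, u). a z u)"
    using adapted by (simp add: adapted_functions_def E_def)
  have exp_a: "exp (4 * a z u) = pd_hol (pd_hol f) z u" if "(z, u) \<in> E" for z u
    using adapted that by (auto simp: adapted_functions_def E_def)
  have Z_a: "Z (a z u) u = z" if "(z, u) \<in> E" for z u
    using adapted that by (auto simp: adapted_functions_def E_def)
  have L_cont: "continuous_on W (\<lambda>(c, u). L c u)"
    using adapted by (simp add: adapted_functions_def E_def W_def)
  have exp_L: "exp (L c u) = pd_hol Z c u" if "(c, u) \<in> W" for c u
    using adapted that by (auto simp: adapted_functions_def E_def W_def)
  obtain h S2 E2 where S2: "open S2" "cis u0 * z0 \<in> S2" "h holomorphic_on S2" "F holomorphic_on S2"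
      "\<And>s. s \<in> S2 \<Longrightarrow> exp (4 * h s) = deriv (deriv F) s"
    and E2: "open E2" "(z0, u0) \<in> E2" "E2 \<subseteq> E" "\<And>z u. (z, u) \<in> E2 \<Longrightarrow> cis u * z \<in> S2"
      "\<And>z u. (z, u) \<in> E2 \<Longrightarrow> a z u = \<i> * of_real u / 2 + h (cis u * z)"
    by (rule local_branch[OF E F_E f_E a_cont exp_a z0]) (assumption | rule that)+
  have "pd_hol a z0 u0 = deriv h (cis u0 * z0) * cis u0"
  proof -
    have "((\<lambda>w. \<i> * of_real u0 / 2 + h (cis u0 * w)) has_field_derivative
        deriv h (cis u0 * z0) * cis u0) (at z0)"
      by (auto intro!: derivative_eq_intros DERIV_chain2[where f = h]
          holomorphic_derivI[OF S2(3,1,2)])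
    moreover have "pd_hol a z0 u0 = deriv (\<lambda>w. \<i> * of_real u0 / 2 + h (cis u0 * w)) z0"
      unfolding pd_hol_def
      by (rule deriv_cong_ev)
        (auto intro: eventually_mono[OF eventually_slice_fst[OF E2(1,2)]] simp: E2(5))
    ultimately show ?thesis by (simp add: DERIV_imp_deriv)
  qed
  \<comment> \<open>This is where the nonvanishing of \<open>alpha\<close> enters: it makes
    \<open>h\<close> locally invertible, which provides \<open>H\<close>.\<close>
  then have "deriv h (cis u0 * z0) \<noteq> 0" using p by (auto simp: p0 alpha_def)
  from has_complex_derivative_locally_invertible[OF S2(3,2,1) this]
  obtain r where r: "r > 0" "ball (cis u0 * z0) r \<subseteq> S2" "open (h ` ball (cis u0 * z0) r)"
    "inj_on h (ball (cis u0 * z0) r)" .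
  define S T where "S = ball (cis u0 * z0) r" and "T = h ` S"
  have S: "open S" "cis u0 * z0 \<in> S" "S \<subseteq> S2" "h holomorphic_on S" "F holomorphic_on S" "inj_on h S"
    using r S2 holomorphic_on_subset by (auto simp: S_def)
  have T: "open T" using r by (simp add: T_def S_def)
  obtain H where H: "H holomorphic_on T" "\<And>s. s \<in> S \<Longrightarrow> H (h s) = s"
    using holomorphic_has_inverse[OF S(4,1,6)] unfolding T_def by metis
  have h_H: "h (H t) = t" "H t \<in> S" if "t \<in> T" for t using that H(2) by (auto simp: T_def)
  \<comment> \<open>Restriction to points whose rotating coordinate lies in the ball
    \<open>S\<close>, on which \<open>h\<close> is injective.\<close>
  define E3 where "E3 = E2 \<inter> (\<lambda>x. cis (snd x) * fst x) -` S"
  have E3: "open E3" unfolding E3_def cis_conv_exp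
    by (intro open_Int E2 open_vimage S continuous_intros)
  define M where "M = D \<inter> (\<lambda>x. (fst x, fst (snd x))) -` E3"
  have M: "open M" unfolding M_def
    using wave by (intro open_Int open_vimage E3 continuous_intros) (simp add: vacuum_pp_wave_def)
  have M_E3: "(z, u) \<in> E3" if "(z, u, v) \<in> M" for z u v using that by (simp add: M_def)
  \<comment> \<open>\<open>Z\<close> and \<open>L\<close> are controlled only on \<open>W\<close>.
    The open set \<open>N\<close> collects the \<open>(c, t)\<close> whose candidate value for
    \<open>Z c t\<close> lands in \<open>E3\<close>; there \<open>a\<close> returns
    \<open>c\<close>, so \<open>(c, t)\<close> lies in \<open>W\<close> and the candidate is the
    true value. Openness of \<open>N\<close> lets \<open>t\<close> vary with \<open>c\<close>
    fixed.\<close>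
  define N1 where "N1 = (\<lambda>x. fst x - \<i> * of_real (snd x) / 2) -` T"
  define \<psi> where "\<psi> = (\<lambda>x. (cis (- snd x) * H (fst x - \<i> * of_real (snd x) / 2), snd x))"
  define N where "N = N1 \<inter> \<psi> -` E3"
  have N1: "open N1" unfolding N1_def by (intro open_vimage T continuous_intros) auto
  have "continuous_on N1 (\<lambda>x. H (fst x - \<i> * of_real (snd x) / 2))"
    by (rule continuous_on_compose2[OF holomorphic_on_imp_continuous_on[OF H(1)]])
      (auto simp: N1_def intro!: continuous_intros)
  then have "continuous_on N1 \<psi>" unfolding \<psi>_def cis_conv_exp by (intro continuous_intros)
  then have N: "open N" unfolding N_def by (rule continuous_open_preimage[OF _ N1 E3])
  have N_Z: "(c, t) \<in> W" "Z c t = cis (- t) * H (c - \<i> * of_real t / 2)" if "(c, t) \<in> N" for c t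
  proof -
    define y where "y = cis (- t) * H (c - \<i> * of_real t / 2)"
    have y: "(y, t) \<in> E3" "c - \<i> * of_real t / 2 \<in> T"
      using that by (simp_all add: N_def N1_def \<psi>_def y_def)
    have "cis t * y = H (c - \<i> * of_real t / 2)"
      by (simp add: y_def cis_mult flip: mult.assoc)
    then have "a y t = c" using E2(5)[of y t] y h_H by (simp add: E3_def)
    moreover have "(y, t) \<in> E" using y E2 by (auto simp: E3_def)
    ultimately show "(c, t) \<in> W" "Z c t = cis (- t) * H (c - \<i> * of_real t / 2)"
      using Z_a[of y t] by (auto simp: W_def y_def intro: rev_image_eqI)
  qed
  have N_L: "exp (L c t) = cis (- t) * deriv H (c - \<i> * of_real t / 2)" if "(c, t) \<in> N" for c t
  proof -
    have cT: "c - \<i> * of_real t / 2 \<in> T" using that by (simp add: N_def N1_def)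
    have "((\<lambda>w. cis (- t) * H (w - \<i> * of_real t / 2)) has_field_derivative
        cis (- t) * (deriv H (c - \<i> * of_real t / 2) * 1)) (at c)"
      by (auto intro!: derivative_eq_intros DERIV_chain2[where f = H] holomorphic_derivI[OF H(1) T cT])
    moreover have "pd_hol Z c t = deriv (\<lambda>w. cis (- t) * H (w - \<i> * of_real t / 2)) c"
      unfolding pd_hol_def
      by (rule deriv_cong_ev)
        (auto intro: eventually_mono[OF eventually_slice_fst[OF N that]] simp: N_Z)
    ultimately show ?thesis using exp_L N_Z(1)[OF that] by (simp add: DERIV_imp_deriv)
  qed
  have a_N: "(a z u, u) \<in> N" if "(z, u) \<in> E3" for z u
  proof -
    have zu: "cis u * z \<in> S" "a z u = \<i> * of_real u / 2 + h (cis u * z)"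
      using that E2(5) by (auto simp: E3_def)
    then have "cis (- u) * H (a z u - \<i> * of_real u / 2) = z"
      by (simp add: H cis_mult flip: mult.assoc)
    with that zu show ?thesis by (simp add: N_def N1_def \<psi>_def T_def)
  qed
  have "rotating_chart f a Z L F g h H S T M"
  proof
    show "open S" "open T" "open M" "h holomorphic_on S" "H holomorphic_on T" "F holomorphic_on S"
      by fact+
    show "h s \<in> T" "H (h s) = s" "exp (4 * h s) = deriv (deriv F) s" if "s \<in> S" for s
      using that H S S2 by (auto simp: T_def)
    show "H t \<in> S" if "t \<in> T" for t using that by (rule h_H)
  next
    fix z u v assume m: "(z, u, v) \<in> M"
    then have zu: "(z, u) \<in> E3" "(z, u) \<in> E" using M_E3 E2 by (auto simp: E3_def)
    show "cis u * z \<in> S" "a z u = \<i> * of_real u / 2 + h (cis u * z)"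
      using zu E2(5) by (auto simp: E3_def)
    have ev: "\<forall>\<^sub>F t in nhds u. (a z u, t) \<in> N"
      by (rule eventually_slice_snd[OF N a_N[OF zu(1)]])
    show "\<forall>\<^sub>F t in nhds u. Z (a z u) t = cis (- t) * H (a z u - \<i> * of_real t / 2)"
      using ev by eventually_elim (rule N_Z)
    show "\<forall>\<^sub>F t in nhds u. exp (L (a z u) t) = cis (- t) * deriv H (a z u - \<i> * of_real t / 2)"
      using ev by eventually_elim (rule N_L)
    have "continuous_on N (\<lambda>(c, u). L c u)"
      by (rule continuous_on_subset[OF L_cont]) (auto intro: N_Z)
    then have "isCont (\<lambda>(c, u). L c u) (a z u, u)"
      using N a_N[OF zu(1)] by (simp add: continuous_on_eq_continuous_at)
    moreover have "isCont (\<lambda>t. (a z u, t)) u" by (intro continuous_intros)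
    ultimately show "isCont (L (a z u)) u"
      using isCont_o2[where f = "\<lambda>t. (a z u, t)" and g = "\<lambda>(c, u). L c u"] by simp
    show "pd_hol f z u = cis u * (deriv F (cis u * z) + g u)"
      by (rule pd_hol_rotating[OF E F_E f_E zu(2)])
    show "g differentiable (at u)"
      by (rule differentiable_coefficient[OF E F_E f_E f_diff zu(2)])
  qed
  moreover have "p \<in> M" using p E2(2) S(2) by (simp add: M_def p0 E3_def)
  moreover have "M \<subseteq> D" by (auto simp: M_def)
  ultimately show thesis by (rule that)
qed

section \<open>Equivalence of the three conditions\<close>

theorem proposition6p6:
  fixes D :: "point set"
    and f a Z L :: zufun
    and F :: "complex \<Rightarrow> complex"
    and g :: "real \<Rightarrow> complex"
  assumes "vacuum_pp_wave D f"
    and "adapted_functions D f a Z L"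
    and "F analytic_on ((\<lambda>(\<zeta>, u, v). cis u * \<zeta>) ` D)"
    and "\<forall>(\<zeta>, u, v) \<in> D. f \<zeta> u = F (cis u * \<zeta>) + g u * cis u * \<zeta>"
    and "\<forall>p\<in>D. alpha a p \<noteq> 0"
    and "\<forall>p\<in>D. mu a L p \<noteq> 0"
    and "\<forall>p\<in>D. inv_A f a Z p * cnj (inv_A f a Z p) \<noteq> 1"
  shows
    "((\<forall>p\<in>D. \<forall>x y w. wedge3 (differential (alpha a) p) (differential (\<lambda>q. cnj (alpha a q)) p)
          (differential (nu f a Z) p) x y w = 0)
        \<longleftrightarrow> (\<forall>p\<in>D. Upsilon_hat f a Z L p = 0)) \<and>
     ((\<forall>p\<in>D. Upsilon_hat f a Z L p = 0)
        \<longleftrightarrow> (\<forall>(\<zeta>, u, v) \<in> D. (g has_vector_derivative 0) (at u)))"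
proof -
  \<comment> \<open>The wedge condition and the vanishing of the last invariant are each compared
    with \<open>g' = 0\<close> at a single point; quantifying over \<open>D\<close> comes
    last.\<close>
  have "((\<forall>x y w. wedge3 (differential (alpha a) (z, u, v))
        (differential (\<lambda>q. cnj (alpha a q)) (z, u, v)) (differential (nu f a Z) (z, u, v)) x y w = 0)
      \<longleftrightarrow> (g has_vector_derivative 0) (at u)) \<and>
      (Upsilon_hat f a Z L (z, u, v) = 0 \<longleftrightarrow> (g has_vector_derivative 0) (at u))"
    if p: "(z, u, v) \<in> D" for z u v
  proof -
    obtain h H S T M where "rotating_chart f a Z L F g h H S T M" and M: "(z, u, v) \<in> M" "M \<subseteq> D"
      using rotating_chart_exists[OF assms(1-4) p] assms(5) p by blast
    then interpret rotating_chart f a Z L F g h H S T M by simp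
    obtain g' where g': "(g has_vector_derivative g') (at u)"
      using g_diff[OF M(1)] vector_derivative_works by blast
    then have iff: "(g has_vector_derivative 0) (at u) \<longleftrightarrow> g' = 0"
      using vector_derivative_at by blast
    have AA: "inv_A f a Z q * cnj (inv_A f a Z q) \<noteq> 1" if "q \<in> M" for q
      using assms(7) M(2) that by blast
    show ?thesis
      unfolding iff wedge3_eq_0_iff[OF M(1) AA[OF M(1)] g']
      using Upsilon_hat_eq[OF M(1) _ g'] AA by simp
  qed
  then show ?thesis by fast
qed

end
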